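(* (Newton summation) I. For every soft species $G \colon \mathbf{Surj} \to \mathbf{Set}$ there is a natural isomorphism $G \xrightarrow{\ \cong\ } \Delta^*[\widetilde{G}]$. II. The functor $\widetilde{(\ )} \colon \mathbf{SoftSp} \to \mathbf{Taut}$ is left adjoint to the functor $\Delta^* \colon \mathbf{Taut} \to \mathbf{SoftSp}$.
   Context: A functor is taut if it preserves inverse image diagrams, i.e. pullback squares in which one leg is a monomorphism (pullbacks of a monomorphism along an arbitrary morphism). A natural transformation is taut if its naturality squares at monomorphisms are pullbacks. $\mathbf{Taut}$ is the category whose objects are taut functors $\mathbf{Set}\to\mathbf{Set}$ and whose morphisms are taut natural transformations (size issues are ignored). $\mathbf{Surj}$ is the category of finite cardinals $n$ (including $0$) and surjections. A soft species is a functor $G \colon \mathbf{Surj} \to \mathbf{Set}$, and $\mathbf{SoftSp} = \mathbf{Set}^{\mathbf{Surj}}$ with all natural transformations. For a soft species $G$, its Newton sum (the corresponding soft analytic functor) is the left Kan extension of $G$ along the inclusion $J \colon \mathbf{Surj} \to \mathbf{Set}$: $$\widetilde{G}(X) = \int^{n \in \mathbf{Surj}} X^n \times G(n).$$ The functor $\widetilde G$ is taut and a natural transformation $t\colon G \to H$ induces a taut transformation $\widetilde{t} \colon \widetilde{G} \to \widetilde{H}$, giving a functor $\widetilde{(\ )} \colon \mathbf{SoftSp}\to\mathbf{Taut}$. For a taut $F \colon \mathbf{Set}\to\mathbf{Set}$, the difference functor is $\Delta[F](X) = F(X+1)\setminus \mathrm{Im}\,F(j_X)$ with $j_X \colon X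 \to X+1$ the coproduct injection; on morphisms it is the restriction of $F(f+1)$; it is again taut, so it can be iterated. The $n$-th iterate satisfies $$\Delta^n[F](0) = \{a \in F(n) \mid a \text{ is not in the image of } F(n_0) \to F(n) \text{ for any proper subset } n_0 \subsetneq n\}.$$ For a surjection $f \colon m \to n$, $F(f)$ restricts to $\Delta^m[F](0) \to \Delta^n[F](0)$, which makes $n \mapsto \Delta^n[F](0)$ a functor $\Delta^*[F] \colon \mathbf{Surj}\to\mathbf{Set}$. A taut transformation $t \colon F \to F'$ induces $\Delta^*[t]$, whose component at $n$ is the restriction of $t(n)$; this defines the functor $\Delta^* \colon \mathbf{Taut} \to \mathbf{SoftSp}$. *)

theory Defs
  imports "HOL-Library.FuncSet"
begin

text \<open>
  Categories are presented by hom-sets, so composition and the arrow part of a functor take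
  the objects involved as arguments: \<open>Comp C a b c g f\<close> is \<open>g \<circ> f\<close> for
  \<open>f : a \<rightarrow> b\<close> and \<open>g : b \<rightarrow> c\<close>, and \<open>fm F a b f\<close> is \<open>F(f)\<close> for \<open>f : a \<rightarrow> b\<close>.
  Functors and natural transformations are required to be \<open>undefined\<close> off their domain, so that
  HOL equality of them is equality of functors, respectively of natural transformations.
\<close>

record ('o, 'm) cat =
  Obj :: "'o set"
  Hom :: "'o \<Rightarrow> 'o \<Rightarrow> 'm set"
  Ide :: "'o \<Rightarrow> 'm"
  Comp :: "'o \<Rightarrow> 'o \<Rightarrow> 'o \<Rightarrow> 'm \<Rightarrow> 'm \<Rightarrow> 'm"

definition is_category :: "('o, 'm) cat \<Rightarrow> bool" where
  "is_category C \<longleftrightarrow>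
    (\<forall>a\<in>Obj C. Ide C a \<in> Hom C a a) \<and>
    (\<forall>a\<in>Obj C. \<forall>b\<in>Obj C. \<forall>c\<in>Obj C. \<forall>f\<in>Hom C a b. \<forall>g\<in>Hom C b c. Comp C a b c g f \<in> Hom C a c) \<and>
    (\<forall>a\<in>Obj C. \<forall>b\<in>Obj C. \<forall>f\<in>Hom C a b.
       Comp C a a b f (Ide C a) = f \<and> Comp C a b b (Ide C b) f = f) \<and>
    (\<forall>a\<in>Obj C. \<forall>b\<in>Obj C. \<forall>c\<in>Obj C. \<forall>d\<in>Obj C. \<forall>f\<in>Hom C a b. \<forall>g\<in>Hom C b c. \<forall>h\<in>Hom C c d.
       Comp C a c d h (Comp C a b c g f) = Comp C a b d (Comp C b c d h g) f)"

definition is_iso :: "('o, 'm) cat \<Rightarrow> 'o \<Rightarrow> 'o \<Rightarrow> 'm \<Rightarrow> bool" where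
  "is_iso C a b f \<longleftrightarrow> a \<in> Obj C \<and> b \<in> Obj C \<and> f \<in> Hom C a b \<and>
    (\<exists>g\<in>Hom C b a. Comp C a b a g f = Ide C a \<and> Comp C b a b f g = Ide C b)"

definition is_mono :: "('o, 'm) cat \<Rightarrow> 'o \<Rightarrow> 'o \<Rightarrow> 'm \<Rightarrow> bool" where
  "is_mono C a b f \<longleftrightarrow> a \<in> Obj C \<and> b \<in> Obj C \<and> f \<in> Hom C a b \<and>
    (\<forall>c\<in>Obj C. \<forall>g\<in>Hom C c a. \<forall>h\<in>Hom C c a. Comp C c a b f g = Comp C c a b f h \<longrightarrow> g = h)"

text \<open>
  \<open>is_pullback C p a b c q r f g\<close>: the square with \<open>q : p \<rightarrow> a\<close>, \<open>r : p \<rightarrow> b\<close>,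
  \<open>f : a \<rightarrow> c\<close>, \<open>g : b \<rightarrow> c\<close> is a pullback.
\<close>

definition is_pullback ::
  "('o, 'm) cat \<Rightarrow> 'o \<Rightarrow> 'o \<Rightarrow> 'o \<Rightarrow> 'o \<Rightarrow> 'm \<Rightarrow> 'm \<Rightarrow> 'm \<Rightarrow> 'm \<Rightarrow> bool" where
  "is_pullback C p a b c q r f g \<longleftrightarrow>
    p \<in> Obj C \<and> a \<in> Obj C \<and> b \<in> Obj C \<and> c \<in> Obj C \<and>
    q \<in> Hom C p a \<and> r \<in> Hom C p b \<and> f \<in> Hom C a c \<and> g \<in> Hom C b c \<and>
    Comp C p a c f q = Comp C p b c g r \<and>
    (\<forall>z\<in>Obj C. \<forall>u\<in>Hom C z a. \<forall>v\<in>Hom C z b. Comp C z a c f u = Comp C z b c g v \<longrightarrow>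
       (\<exists>!w. w \<in> Hom C z p \<and> Comp C z p a q w = u \<and> Comp C z p b r w = v))"

record ('o, 'm, 'p, 'n) ftor =
  fo :: "'o \<Rightarrow> 'p"
  fm :: "'o \<Rightarrow> 'o \<Rightarrow> 'm \<Rightarrow> 'n"

definition ftor_on :: "('o, 'm) cat \<Rightarrow> ('o \<Rightarrow> 'p) \<Rightarrow> ('o \<Rightarrow> 'o \<Rightarrow> 'm \<Rightarrow> 'n) \<Rightarrow> ('o, 'm, 'p, 'n) ftor" where
  "ftor_on C ob ar =
    \<lparr>fo = (\<lambda>a\<in>Obj C. ob a),
     fm = (\<lambda>a b f. if a \<in> Obj C \<and> b \<in> Obj C \<and> f \<in> Hom C a b then ar a b f else undefined)\<rparr>"

definition is_functor :: "('o, 'm) cat \<Rightarrow> ('p, 'n) cat \<Rightarrow> ('o, 'm, 'p, 'n) ftor \<Rightarrow> bool" where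
  "is_functor C D F \<longleftrightarrow>
    is_category C \<and> is_category D \<and>
    (\<forall>a\<in>Obj C. fo F a \<in> Obj D) \<and>
    (\<forall>a\<in>Obj C. \<forall>b\<in>Obj C. \<forall>f\<in>Hom C a b. fm F a b f \<in> Hom D (fo F a) (fo F b)) \<and>
    (\<forall>a\<in>Obj C. fm F a a (Ide C a) = Ide D (fo F a)) \<and>
    (\<forall>a\<in>Obj C. \<forall>b\<in>Obj C. \<forall>c\<in>Obj C. \<forall>f\<in>Hom C a b. \<forall>g\<in>Hom C b c.
       fm F a c (Comp C a b c g f) = Comp D (fo F a) (fo F b) (fo F c) (fm F b c g) (fm F a b f)) \<and>
    F = ftor_on C (fo F) (fm F)"

definition id_functor :: "('o, 'm) cat \<Rightarrow> ('o, 'm, 'o, 'm) ftor" where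
  "id_functor C = ftor_on C (\<lambda>a. a) (\<lambda>a b f. f)"

definition functor_comp ::
  "('o, 'm) cat \<Rightarrow> ('p, 'n, 'q, 'k) ftor \<Rightarrow> ('o, 'm, 'p, 'n) ftor \<Rightarrow> ('o, 'm, 'q, 'k) ftor" where
  "functor_comp C G F =
    ftor_on C (\<lambda>a. fo G (fo F a)) (\<lambda>a b f. fm G (fo F a) (fo F b) (fm F a b f))"

definition nat_trans ::
  "('o, 'm) cat \<Rightarrow> ('p, 'n) cat \<Rightarrow> ('o, 'm, 'p, 'n) ftor \<Rightarrow> ('o, 'm, 'p, 'n) ftor \<Rightarrow> ('o \<Rightarrow> 'n) \<Rightarrow> bool" where
  "nat_trans C D F G t \<longleftrightarrow>
    is_functor C D F \<and> is_functor C D G \<and> t \<in> extensional (Obj C) \<and>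
    (\<forall>a\<in>Obj C. t a \<in> Hom D (fo F a) (fo G a)) \<and>
    (\<forall>a\<in>Obj C. \<forall>b\<in>Obj C. \<forall>f\<in>Hom C a b.
       Comp D (fo F a) (fo F b) (fo G b) (t b) (fm F a b f) =
       Comp D (fo F a) (fo G a) (fo G b) (fm G a b f) (t a))"

definition natural_iso ::
  "('o, 'm) cat \<Rightarrow> ('p, 'n) cat \<Rightarrow> ('o, 'm, 'p, 'n) ftor \<Rightarrow> ('o, 'm, 'p, 'n) ftor \<Rightarrow> ('o \<Rightarrow> 'n) \<Rightarrow> bool" where
  "natural_iso C D F G t \<longleftrightarrow>
    nat_trans C D F G t \<and> (\<forall>a\<in>Obj C. is_iso D (fo F a) (fo G a) (t a))"

definition trans_id :: "('o, 'm) cat \<Rightarrow> ('p, 'n) cat \<Rightarrow> ('o, 'm, 'p, 'n) ftor \<Rightarrow> 'o \<Rightarrow> 'n" where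
  "trans_id C D F = (\<lambda>a\<in>Obj C. Ide D (fo F a))"

definition trans_comp ::
  "('o, 'm) cat \<Rightarrow> ('p, 'n) cat \<Rightarrow> ('o, 'm, 'p, 'n) ftor \<Rightarrow> ('o, 'm, 'p, 'n) ftor \<Rightarrow>
   ('o, 'm, 'p, 'n) ftor \<Rightarrow> ('o \<Rightarrow> 'n) \<Rightarrow> ('o \<Rightarrow> 'n) \<Rightarrow> 'o \<Rightarrow> 'n" where
  "trans_comp C D F G H s t = (\<lambda>a\<in>Obj C. Comp D (fo F a) (fo G a) (fo H a) (s a) (t a))"

definition functor_category ::
  "('o, 'm) cat \<Rightarrow> ('p, 'n) cat \<Rightarrow> (('o, 'm, 'p, 'n) ftor, 'o \<Rightarrow> 'n) cat" where
  "functor_category C D =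
    \<lparr>Obj = {F. is_functor C D F},
     Hom = (\<lambda>F G. {t. nat_trans C D F G t}),
     Ide = trans_id C D,
     Comp = trans_comp C D\<rparr>"

definition left_adjoint ::
  "('o, 'm) cat \<Rightarrow> ('p, 'n) cat \<Rightarrow> ('o, 'm, 'p, 'n) ftor \<Rightarrow> ('p, 'n, 'o, 'm) ftor \<Rightarrow> bool" where
  "left_adjoint C D L R \<longleftrightarrow>
    is_functor C D L \<and> is_functor D C R \<and>
    (\<exists>\<phi>. (\<forall>c\<in>Obj C. \<forall>d\<in>Obj D. bij_betw (\<phi> c d) (Hom D (fo L c) d) (Hom C c (fo R d))) \<and>
      (\<forall>c\<in>Obj C. \<forall>c'\<in>Obj C. \<forall>d\<in>Obj D. \<forall>d'\<in>Obj D.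
        \<forall>h\<in>Hom C c' c. \<forall>k\<in>Hom D d d'. \<forall>f\<in>Hom D (fo L c) d.
          \<phi> c' d' (Comp D (fo L c') d d' k (Comp D (fo L c') (fo L c) d f (fm L c' c h))) =
          Comp C c' (fo R d) (fo R d') (fm R d d' k) (Comp C c' c (fo R d) (\<phi> c d f) h)))"

definition taut_functor :: "('o, 'm) cat \<Rightarrow> ('p, 'n) cat \<Rightarrow> ('o, 'm, 'p, 'n) ftor \<Rightarrow> bool" where
  "taut_functor C D F \<longleftrightarrow> is_functor C D F \<and>
    (\<forall>p a b c q r f g. is_pullback C p a b c q r f g \<and> is_mono C b c g \<longrightarrow>
       is_pullback D (fo F p) (fo F a) (fo F b) (fo F c)
         (fm F p a q) (fm F p b r) (fm F a c f) (fm F b c g))"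

definition taut_trans ::
  "('o, 'm) cat \<Rightarrow> ('p, 'n) cat \<Rightarrow> ('o, 'm, 'p, 'n) ftor \<Rightarrow> ('o, 'm, 'p, 'n) ftor \<Rightarrow> ('o \<Rightarrow> 'n) \<Rightarrow> bool" where
  "taut_trans C D F G t \<longleftrightarrow> nat_trans C D F G t \<and>
    (\<forall>a b m. is_mono C a b m \<longrightarrow>
       is_pullback D (fo F a) (fo F b) (fo G a) (fo G b) (fm F a b m) (t a) (t b) (fm G a b m))"

text \<open>
  There is no HOL type of all sets, so Set is the category of the sets belonging to a universe
  \<open>V\<close> of subsets of a type \<open>'u\<close>.  The closure conditions say that \<open>V\<close> contains subsets
  of its members, singletons, unions of families indexed by a member (hence also images of its
  members, by taking unions of singletons), and an infinite set.  If the cardinality of \<open>'u\<close> is an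
  uncountable inaccessible cardinal \<open>\<kappa>\<close>, the subsets of cardinality less than \<open>\<kappa>\<close>
  form such a \<open>V\<close>, and Set is then the category of small sets of a Grothendieck universe;
  closure under power sets is not required, and the powerset of any infinite type is also an
  instance.
\<close>

definition set_universe :: "'u set set \<Rightarrow> bool" where
  "set_universe V \<longleftrightarrow>
    (\<forall>A\<in>V. \<forall>B. B \<subseteq> A \<longrightarrow> B \<in> V) \<and>
    (\<forall>x. {x} \<in> V) \<and>
    (\<forall>I\<in>V. \<forall>A :: 'u \<Rightarrow> 'u set. (\<forall>i\<in>I. A i \<in> V) \<longrightarrow> (\<Union>i\<in>I. A i) \<in> V) \<and>
    (\<exists>A\<in>V. infinite A)"

lemma set_universe_Pow_UNIV:
  assumes "infinite (UNIV :: 'u set)"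
  shows "set_universe (Pow (UNIV :: 'u set))"
  using assms by (auto simp: set_universe_def)

definition SET :: "'u set set \<Rightarrow> ('u set, 'u \<Rightarrow> 'u) cat" where
  "SET V =
    \<lparr>Obj = V,
     Hom = (\<lambda>X Y. X \<rightarrow>\<^sub>E Y),
     Ide = (\<lambda>X. \<lambda>x\<in>X. x),
     Comp = (\<lambda>X Y Z g f. compose X g f)\<rparr>"

text \<open>
  The coproduct \<open>X + 1\<close> is realised inside \<open>'u\<close> by a fixed injection of \<open>'u option\<close>
  (one exists since \<open>'u\<close> is infinite).
\<close>

definition opt_code :: "'u option \<Rightarrow> 'u" where
  "opt_code = (SOME e. inj e)"

definition plus_one :: "'u set \<Rightarrow> 'u set" where
  "plus_one X = opt_code ` insert None (Some ` X)"

definition plus_one_inj :: "'u set \<Rightarrow> 'u \<Rightarrow> 'u" where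
  "plus_one_inj X = (\<lambda>x\<in>X. opt_code (Some x))"

definition plus_one_map :: "'u set \<Rightarrow> ('u \<Rightarrow> 'u) \<Rightarrow> 'u \<Rightarrow> 'u" where
  "plus_one_map X f = (\<lambda>z\<in>plus_one X. opt_code (map_option f (inv opt_code z)))"

text \<open>The finite cardinal \<open>n\<close> is the \<open>n\<close>-fold sum \<open>0 + 1 + \<dots> + 1\<close>.\<close>

definition fincard :: "nat \<Rightarrow> 'u set" where
  "fincard n = (plus_one ^^ n) {}"

text \<open>
  Objects are named by natural numbers, but arrows \<open>m \<rightarrow> n\<close> are the surjections of the sets
  \<open>fincard m \<rightarrow> fincard n\<close>; thus the inclusion \<open>J\<close> into Set is \<open>fincard\<close> on objects and the
  identity on arrows.
\<close>

definition Surj :: "(nat, 'u \<Rightarrow> 'u) cat" where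
  "Surj =
    \<lparr>Obj = UNIV,
     Hom = (\<lambda>m n. {f \<in> fincard m \<rightarrow>\<^sub>E fincard n. f ` fincard m = fincard n}),
     Ide = (\<lambda>n. \<lambda>x\<in>fincard n. x),
     Comp = (\<lambda>m n k g f. compose (fincard m) g f)\<rparr>"

type_synonym 'u soft_species = "(nat, 'u \<Rightarrow> 'u, 'u set, 'u \<Rightarrow> 'u) ftor"
type_synonym 'u set_functor = "('u set, 'u \<Rightarrow> 'u, 'u set, 'u \<Rightarrow> 'u) ftor"

definition SoftSp :: "'u set set \<Rightarrow> ('u soft_species, nat \<Rightarrow> 'u \<Rightarrow> 'u) cat" where
  "SoftSp V = functor_category Surj (SET V)"

definition Taut :: "'u set set \<Rightarrow> ('u set_functor, 'u set \<Rightarrow> 'u \<Rightarrow> 'u) cat" where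
  "Taut V =
    \<lparr>Obj = {F. taut_functor (SET V) (SET V) F},
     Hom = (\<lambda>F G. {t. taut_trans (SET V) (SET V) F G t}),
     Ide = trans_id (SET V) (SET V),
     Comp = trans_comp (SET V) (SET V)\<rparr>"

text \<open>
  The coend of \<open>X\<^sup>n \<times> G(n)\<close> over \<open>n \<in> Surj\<close> is the quotient of the disjoint sum of the
  sets \<open>X\<^sup>n \<times> G(n)\<close> by the equivalence generated by
  \<open>(m, x \<circ> f, a) \<sim> (n, x, G(f)(a))\<close> for \<open>f : m \<rightarrow> n\<close> in Surj, \<open>x \<in> X\<^sup>n\<close>, \<open>a \<in> G(m)\<close>.
\<close>

definition newton_pre :: "'u soft_species \<Rightarrow> 'u set \<Rightarrow> (nat \<times> ('u \<Rightarrow> 'u) \<times> 'u) set" where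
  "newton_pre G X = {(n, x, a). x \<in> fincard n \<rightarrow>\<^sub>E X \<and> a \<in> fo G n}"

definition newton_step :: "'u soft_species \<Rightarrow> 'u set \<Rightarrow> (nat \<times> ('u \<Rightarrow> 'u) \<times> 'u) rel" where
  "newton_step G X =
    {((m, compose (fincard m) x f, a), (n, x, fm G m n f a)) | m n f x a.
       f \<in> Hom Surj m n \<and> x \<in> fincard n \<rightarrow>\<^sub>E X \<and> a \<in> fo G m}"

definition newton_rel :: "'u soft_species \<Rightarrow> 'u set \<Rightarrow> (nat \<times> ('u \<Rightarrow> 'u) \<times> 'u) rel" where
  "newton_rel G X =
    (newton_step G X \<union> (newton_step G X)\<inverse>)\<^sup>* \<inter> newton_pre G X \<times> newton_pre G X"

text \<open>
  The quotient is transported into \<open>'u\<close> by coding a representative of each class.  The code is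
  injective on all triples \<open>(n, x, a)\<close> with \<open>x\<close> extensional on the finite set \<open>fincard n\<close>,
  which is possible because \<open>'u\<close> is infinite.
\<close>

definition triple_code :: "nat \<times> ('u \<Rightarrow> 'u) \<times> 'u \<Rightarrow> 'u" where
  "triple_code = (SOME e. inj_on e {(n, x, a). x \<in> extensional (fincard n)})"

definition class_code :: "(nat \<times> ('u \<Rightarrow> 'u) \<times> 'u) set \<Rightarrow> 'u" where
  "class_code c = triple_code (SOME t. t \<in> c)"

definition newton_in :: "'u soft_species \<Rightarrow> 'u set \<Rightarrow> nat \<times> ('u \<Rightarrow> 'u) \<times> 'u \<Rightarrow> 'u" where
  "newton_in G X t = class_code (newton_rel G X `` {t})"

definition newton_obj :: "'u soft_species \<Rightarrow> 'u set \<Rightarrow> 'u set" where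
  "newton_obj G X = class_code ` (newton_pre G X // newton_rel G X)"

definition newton_arr :: "'u soft_species \<Rightarrow> 'u set \<Rightarrow> 'u set \<Rightarrow> ('u \<Rightarrow> 'u) \<Rightarrow> 'u \<Rightarrow> 'u" where
  "newton_arr G X Y f = (\<lambda>z\<in>newton_obj G X. THE w.
     \<exists>n x a. (n, x, a) \<in> newton_pre G X \<and> z = newton_in G X (n, x, a) \<and>
       w = newton_in G Y (n, compose (fincard n) f x, a))"

definition newton_sum :: "'u set set \<Rightarrow> 'u soft_species \<Rightarrow> 'u set_functor" where
  "newton_sum V G = ftor_on (SET V) (newton_obj G) (newton_arr G)"

definition newton_trans ::
  "'u set set \<Rightarrow> 'u soft_species \<Rightarrow> 'u soft_species \<Rightarrow> (nat \<Rightarrow> 'u \<Rightarrow> 'u) \<Rightarrow> 'u set \<Rightarrow> 'u \<Rightarrow> 'u" where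
  "newton_trans V G H t = (\<lambda>X\<in>V. \<lambda>z\<in>newton_obj G X. THE w.
     \<exists>n x a. (n, x, a) \<in> newton_pre G X \<and> z = newton_in G X (n, x, a) \<and>
       w = newton_in H X (n, x, t n a))"

definition Newton ::
  "'u set set \<Rightarrow> ('u soft_species, nat \<Rightarrow> 'u \<Rightarrow> 'u, 'u set_functor, 'u set \<Rightarrow> 'u \<Rightarrow> 'u) ftor" where
  "Newton V = ftor_on (SoftSp V) (newton_sum V) (newton_trans V)"

definition diff_obj :: "'u set_functor \<Rightarrow> 'u set \<Rightarrow> 'u set" where
  "diff_obj F X = fo F (plus_one X) - fm F X (plus_one X) (plus_one_inj X) ` fo F X"

definition difference :: "'u set set \<Rightarrow> 'u set_functor \<Rightarrow> 'u set_functor" where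
  "difference V F = ftor_on (SET V) (diff_obj F)
     (\<lambda>X Y f. restrict (fm F (plus_one X) (plus_one Y) (plus_one_map X f)) (diff_obj F X))"

text \<open>
  Since \<open>fincard n\<close> is \<open>0 + 1 + \<dots> + 1\<close>, the value at \<open>0\<close> of the \<open>n\<close>-th iterated
  difference of \<open>F\<close> is literally a subset of \<open>F(fincard n)\<close>.
\<close>

definition iter_diff_zero :: "'u set set \<Rightarrow> 'u set_functor \<Rightarrow> nat \<Rightarrow> 'u set" where
  "iter_diff_zero V F n = fo ((difference V ^^ n) F) {}"

definition diff_star :: "'u set set \<Rightarrow> 'u set_functor \<Rightarrow> 'u soft_species" where
  "diff_star V F = ftor_on Surj (iter_diff_zero V F)
     (\<lambda>m n f. restrict (fm F (fincard m) (fincard n) f) (iter_diff_zero V F m))"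

definition diff_star_trans ::
  "'u set set \<Rightarrow> 'u set_functor \<Rightarrow> 'u set_functor \<Rightarrow> ('u set \<Rightarrow> 'u \<Rightarrow> 'u) \<Rightarrow> nat \<Rightarrow> 'u \<Rightarrow> 'u" where
  "diff_star_trans V F F' t = (\<lambda>n. restrict (t (fincard n)) (iter_diff_zero V F n))"

definition DeltaStar ::
  "'u set set \<Rightarrow> ('u set_functor, 'u set \<Rightarrow> 'u \<Rightarrow> 'u, 'u soft_species, nat \<Rightarrow> 'u \<Rightarrow> 'u) ftor" where
  "DeltaStar V = ftor_on (Taut V) (diff_star V) (diff_star_trans V)"

end

theory Submission
  imports Defs
begin

text \<open>
  Each class of a Newton sum has a normal form: \<open>(n, x, a)\<close> is pushed forward along the surjection
  of \<open>n\<close> onto the image of \<open>x\<close>, and two triples are identified in the coend precisely when the images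
  agree and so do the pushed-forward elements.  Hence the class lies in the image of
  \<open>G~(S) \<rightarrow> G~(X)\<close> iff \<open>x\<close> takes its values in \<open>S\<close>, which gives tautness, and the elements of
  \<open>G~(n)\<close> outside all proper subsets of \<open>n\<close> are the classes of \<open>(n, id, b)\<close>, with \<open>b\<close> unique;
  this is the unit \<open>b \<mapsto> [n, id, b]\<close>.

  For the adjunction, \<open>s : G \<rightarrow> \<Delta>*[F]\<close> corresponds to \<open>[n, x, a] \<mapsto> F(x)(s a)\<close>.  That
  transformation is taut since \<open>s a\<close> comes from no proper subset of \<open>n\<close>: if \<open>F(x)(s a)\<close> comes from
  \<open>S\<close>, tautness of \<open>F\<close> brings \<open>s a\<close> from the inverse image of \<open>S\<close> under \<open>x\<close>, which is then all of \<open>n\<close>.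
\<close>

subsection \<open>Functor categories\<close>

text \<open>Tautness is a condition on pullback squares, but over Set the leg opposite to a
  monomorphism is injective as well, and what remains of the universal property is a statement about
  images. Every map of sets is a split surjection onto its image, so only images of subset
  inclusions matter, and \<open>img F X S\<close> is the language of nearly all arguments.
  Injectivity needs separate care: an injection with empty domain need not have a retraction, so an
  arbitrary functor may destroy it.

  Elements of a Newton sum are codes of chosen representatives, and maps out of it are descriptions
  ranging over all representing triples, so each needs independence of the representative. A single
  factorization supplies it: equivalent triples reduce, by one generating step each, to the same
  triple, whose map into X is the inclusion of the common image read through a fixed numbering.

  The iterated difference is a recursion on the functor, whose step passes from X to X + 1. Its
  value at 0 is therefore found through a description valid at every X.\<close>

lemma SET_sel [simp]:
  "Obj (SET V) = V"
  "Hom (SET V) = (\<lambda>X Y. X \<rightarrow>\<^sub>E Y)"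
  "Ide (SET V) = (\<lambda>X. \<lambda>x\<in>X. x)"
  "Comp (SET V) = (\<lambda>X Y Z g f. compose X g f)"
  by (simp_all add: SET_def)

lemma Surj_sel [simp]:
  "Obj Surj = UNIV"
  "Hom Surj = (\<lambda>m n. {f \<in> fincard m \<rightarrow>\<^sub>E fincard n. f ` fincard m = fincard n})"
  "Ide Surj = (\<lambda>n. \<lambda>x\<in>fincard n. x)"
  "Comp Surj = (\<lambda>m n k g f. compose (fincard m) g f)"
  by (simp_all add: Surj_def)

lemma Taut_sel [simp]:
  "Obj (Taut V) = {F. taut_functor (SET V) (SET V) F}"
  "Hom (Taut V) = (\<lambda>F G. {t. taut_trans (SET V) (SET V) F G t})"
  "Ide (Taut V) = trans_id (SET V) (SET V)"
  "Comp (Taut V) = trans_comp (SET V) (SET V)"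
  by (simp_all add: Taut_def)

lemma SoftSp_sel [simp]:
  "Obj (SoftSp V) = {F. is_functor Surj (SET V) F}"
  "Hom (SoftSp V) = (\<lambda>F G. {t. nat_trans Surj (SET V) F G t})"
  "Ide (SoftSp V) = trans_id Surj (SET V)"
  "Comp (SoftSp V) = trans_comp Surj (SET V)"
  by (simp_all add: SoftSp_def functor_category_def)

lemma ftor_on_sel [simp]:
  "a \<in> Obj C \<Longrightarrow> fo (ftor_on C ob ar) a = ob a"
  "a \<in> Obj C \<Longrightarrow> b \<in> Obj C \<Longrightarrow> f \<in> Hom C a b \<Longrightarrow> fm (ftor_on C ob ar) a b f = ar a b f"
  by (simp_all add: ftor_on_def)

lemma ftor_on_idem: "ftor_on C (fo (ftor_on C ob ar)) (fm (ftor_on C ob ar)) = ftor_on C ob ar"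
  by (auto simp: ftor_on_def fun_eq_iff restrict_def)

text \<open>Cutting off outside the domain is idempotent, so the last clause of
  \<open>is_functor\<close> is automatic for an \<open>ftor_on\<close>. The other laws mention the
  arrow part at identities and composites, where it unfolds because these lie in the
  hom-sets.\<close>

lemma is_functor_ftor_onI:
  assumes "is_category C" "is_category D"
    and "\<And>a. a \<in> Obj C \<Longrightarrow> ob a \<in> Obj D"
    and "\<And>a b f. a \<in> Obj C \<Longrightarrow> b \<in> Obj C \<Longrightarrow> f \<in> Hom C a b \<Longrightarrow> ar a b f \<in> Hom D (ob a) (ob b)"
    and "\<And>a. a \<in> Obj C \<Longrightarrow> ar a a (Ide C a) = Ide D (ob a)"
    and "\<And>a b c f g. a \<in> Obj C \<Longrightarrow> b \<in> Obj C \<Longrightarrow> c \<in> Obj C \<Longrightarrow> f \<in> Hom C a b \<Longrightarrow>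
       g \<in> Hom C b c \<Longrightarrow> ar a c (Comp C a b c g f) = Comp D (ob a) (ob b) (ob c) (ar b c g) (ar a b f)"
  shows "is_functor C D (ftor_on C ob ar)"
proof -
  have "Ide C a \<in> Hom C a a" if "a \<in> Obj C" for a
    using assms(1) that by (simp add: is_category_def)
  moreover have "Comp C a b c g f \<in> Hom C a c"
    if "a \<in> Obj C" "b \<in> Obj C" "c \<in> Obj C" "f \<in> Hom C a b" "g \<in> Hom C b c" for a b c f g
    using assms(1) that unfolding is_category_def by blast
  ultimately show ?thesis
    unfolding is_functor_def using assms by (simp add: ftor_on_idem)
qed

lemma category_SET: "is_category (SET V)"
  unfolding is_category_def
  by (auto simp: compose_def fun_eq_iff restrict_def PiE_iff extensional_def)

lemma category_Surj: "is_category Surj"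
  unfolding is_category_def
  by (auto simp: compose_def restrict_def PiE_iff extensional_def image_iff fun_eq_iff)
     (metis imageI image_iff)+

lemma compose_PiE: "f \<in> X \<rightarrow>\<^sub>E Y \<Longrightarrow> g \<in> Y \<rightarrow>\<^sub>E Z \<Longrightarrow> compose X g f \<in> X \<rightarrow>\<^sub>E Z"
  by (auto simp: compose_def)

lemma id_PiE: "S \<subseteq> X \<Longrightarrow> (\<lambda>x\<in>S. x) \<in> S \<rightarrow>\<^sub>E X"
  by auto


lemma is_categoryD:
  assumes "is_category C"
  shows "a \<in> Obj C \<Longrightarrow> Ide C a \<in> Hom C a a"
    and "a \<in> Obj C \<Longrightarrow> b \<in> Obj C \<Longrightarrow> c \<in> Obj C \<Longrightarrow> f \<in> Hom C a b \<Longrightarrow> g \<in> Hom C b c \<Longrightarrow>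
      Comp C a b c g f \<in> Hom C a c"
    and "a \<in> Obj C \<Longrightarrow> b \<in> Obj C \<Longrightarrow> f \<in> Hom C a b \<Longrightarrow> Comp C a a b f (Ide C a) = f"
    and "a \<in> Obj C \<Longrightarrow> b \<in> Obj C \<Longrightarrow> f \<in> Hom C a b \<Longrightarrow> Comp C a b b (Ide C b) f = f"
  using assms by (auto simp: is_category_def)

lemma is_category_assoc:
  assumes "is_category C" "a \<in> Obj C" "b \<in> Obj C" "c \<in> Obj C" "d \<in> Obj C"
    "f \<in> Hom C a b" "g \<in> Hom C b c" "h \<in> Hom C c d"
  shows "Comp C a c d h (Comp C a b c g f) = Comp C a b d (Comp C b c d h g) f"
  using assms unfolding is_category_def by blast

lemma is_functorD:
  assumes "is_functor C D F"
  shows "a \<in> Obj C \<Longrightarrow> fo F a \<in> Obj D"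
    and "a \<in> Obj C \<Longrightarrow> b \<in> Obj C \<Longrightarrow> f \<in> Hom C a b \<Longrightarrow> fm F a b f \<in> Hom D (fo F a) (fo F b)"
    and "a \<in> Obj C \<Longrightarrow> fm F a a (Ide C a) = Ide D (fo F a)"
    and "a \<in> Obj C \<Longrightarrow> b \<in> Obj C \<Longrightarrow> c \<in> Obj C \<Longrightarrow> f \<in> Hom C a b \<Longrightarrow> g \<in> Hom C b c \<Longrightarrow>
      fm F a c (Comp C a b c g f) = Comp D (fo F a) (fo F b) (fo F c) (fm F b c g) (fm F a b f)"
  using assms by (auto simp: is_functor_def)

lemma nat_transD:
  assumes "nat_trans C D F G t"
  shows "is_functor C D F" "is_functor C D G" "t \<in> extensional (Obj C)"
    and "a \<in> Obj C \<Longrightarrow> t a \<in> Hom D (fo F a) (fo G a)"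
    and "a \<in> Obj C \<Longrightarrow> b \<in> Obj C \<Longrightarrow> f \<in> Hom C a b \<Longrightarrow>
       Comp D (fo F a) (fo F b) (fo G b) (t b) (fm F a b f) =
       Comp D (fo F a) (fo G a) (fo G b) (fm G a b f) (t a)"
  using assms by (auto simp: nat_trans_def)

lemma nat_trans_id:
  assumes F: "is_functor C D F"
  shows "nat_trans C D F F (trans_id C D F)"
proof -
  have "is_category D" using F by (simp add: is_functor_def)
  then show ?thesis
    unfolding nat_trans_def trans_id_def using F
    by (auto simp: is_categoryD is_functorD)
qed

lemma nat_trans_comp:
  assumes t: "nat_trans C D F G t" and s: "nat_trans C D G H s"
  shows "nat_trans C D F H (trans_comp C D F G H s t)"
proof -
  have F: "is_functor C D F" and G: "is_functor C D G" and H: "is_functor C D H"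
    using t s by (auto simp: nat_trans_def)
  have D: "is_category D" using F by (simp add: is_functor_def)
  have "Comp D (fo F a) (fo F b) (fo H b) (Comp D (fo F b) (fo G b) (fo H b) (s b) (t b)) (fm F a b f)
      = Comp D (fo F a) (fo H a) (fo H b) (fm H a b f) (Comp D (fo F a) (fo G a) (fo H a) (s a) (t a))"
    (is "?lhs = ?rhs") if "a \<in> Obj C" "b \<in> Obj C" "f \<in> Hom C a b" for a b f
  proof -
    note arr = that is_functorD(1,2)[OF F] is_functorD(1,2)[OF G] is_functorD(1,2)[OF H]
      nat_transD(4)[OF t] nat_transD(4)[OF s]
    have "?lhs = Comp D (fo F a) (fo G b) (fo H b) (s b)
        (Comp D (fo F a) (fo F b) (fo G b) (t b) (fm F a b f))"
      by (rule is_category_assoc[OF D, symmetric]) (simp_all add: arr)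
    also have "\<dots> = Comp D (fo F a) (fo G b) (fo H b) (s b)
        (Comp D (fo F a) (fo G a) (fo G b) (fm G a b f) (t a))"
      by (simp only: nat_transD(5)[OF t that])
    also have "\<dots> = Comp D (fo F a) (fo G a) (fo H b)
        (Comp D (fo G a) (fo G b) (fo H b) (s b) (fm G a b f)) (t a)"
      by (rule is_category_assoc[OF D]) (simp_all add: arr)
    also have "\<dots> = Comp D (fo F a) (fo G a) (fo H b)
        (Comp D (fo G a) (fo H a) (fo H b) (fm H a b f) (s a)) (t a)"
      by (simp only: nat_transD(5)[OF s that])
    also have "\<dots> = ?rhs"
      by (rule is_category_assoc[OF D, symmetric]) (simp_all add: arr)
    finally show ?thesis .
  qed
  then show ?thesis
    unfolding nat_trans_def trans_comp_def using F G H
      nat_transD(4)[OF t] nat_transD(4)[OF s]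
    by (auto simp: is_categoryD(2)[OF D] is_functorD)
qed

lemma trans_comp_id:
  assumes t: "nat_trans C D F G t"
  shows "trans_comp C D F F G t (trans_id C D F) = t"
    and "trans_comp C D F G G (trans_id C D G) t = t"
proof -
  have F: "is_functor C D F" and G: "is_functor C D G" and D: "is_category D"
    using t by (auto simp: nat_trans_def is_functor_def)
  show "trans_comp C D F F G t (trans_id C D F) = t"
    and "trans_comp C D F G G (trans_id C D G) t = t"
    using nat_transD(3,4)[OF t] is_functorD(1)[OF F] is_functorD(1)[OF G]
    by (auto simp: trans_comp_def trans_id_def is_categoryD[OF D] fun_eq_iff restrict_def extensional_def)
qed

lemma trans_comp_assoc:
  assumes t: "nat_trans C D F G t" and s: "nat_trans C D G H s" and r: "nat_trans C D H K r"
  shows "trans_comp C D F H K r (trans_comp C D F G H s t)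
    = trans_comp C D F G K (trans_comp C D G H K r s) t"
proof -
  have F: "is_functor C D F" and G: "is_functor C D G" and H: "is_functor C D H"
    and K: "is_functor C D K" and D: "is_category D"
    using t s r by (auto simp: nat_trans_def is_functor_def)
  show ?thesis
    using nat_transD(4)[OF t] nat_transD(4)[OF s] nat_transD(4)[OF r]
      is_functorD(1)[OF F] is_functorD(1)[OF G] is_functorD(1)[OF H] is_functorD(1)[OF K]
    by (auto simp: trans_comp_def is_category_assoc[OF D] fun_eq_iff restrict_def)
qed

lemma category_functor_category: "is_category (functor_category C D)"
  unfolding is_category_def functor_category_def
  by (simp add: nat_trans_id nat_trans_comp trans_comp_id trans_comp_assoc)

lemma category_SoftSp: "is_category (SoftSp V)"
  unfolding SoftSp_def by (rule category_functor_category)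

lemma functor_id: "is_category C \<Longrightarrow> is_functor C C (id_functor C)"
  unfolding id_functor_def by (rule is_functor_ftor_onI) auto

lemma functor_functor_comp:
  assumes F: "is_functor C D F" and G: "is_functor D E G"
  shows "is_functor C E (functor_comp C G F)"
  unfolding functor_comp_def
  using F G by (intro is_functor_ftor_onI) (simp_all add: is_functorD, simp_all add: is_functor_def)

subsection \<open>Pullbacks and monomorphisms of sets\<close>

locale universe =
  fixes V :: "'u set set"
  assumes universe: "set_universe V"
begin

lemma V_subset: "A \<in> V \<Longrightarrow> B \<subseteq> A \<Longrightarrow> B \<in> V"
  using universe unfolding set_universe_def by blast

lemma V_singleton: "{x} \<in> V"
  using universe unfolding set_universe_def by blast

lemma V_UN: "I \<in> V \<Longrightarrow> (\<And>i. i \<in> I \<Longrightarrow> A i \<in> V) \<Longrightarrow> (\<Union>i\<in>I. A i) \<in> V"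
  for A :: "'u \<Rightarrow> 'u set"
  using universe unfolding set_universe_def by blast

lemma V_infinite: "\<exists>A\<in>V. infinite A"
  using universe unfolding set_universe_def by blast

lemma V_empty: "{} \<in> V"
  by (rule V_subset[OF V_singleton]) simp

lemma infinite_UNIV: "infinite (UNIV :: 'u set)"
  using V_infinite by (auto dest: finite_subset[OF subset_UNIV])

lemma V_image: "A \<in> V \<Longrightarrow> f ` A \<in> V" for f :: "'u \<Rightarrow> 'u"
  using V_UN[of A "\<lambda>a. {f a}"] V_singleton by (simp add: UNION_singleton_eq_range)

text \<open>Unions in V are indexed by elements of \<open>'u\<close>, so the naturals are first
  embedded into an infinite member of V.\<close>

lemma V_countable_UN:
  fixes B :: "nat \<Rightarrow> 'u set"
  assumes "\<And>n. B n \<in> V"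
  shows "(\<Union>n. B n) \<in> V"
proof -
  obtain A where A: "A \<in> V" "infinite A" using V_infinite by blast
  then obtain g :: "nat \<Rightarrow> 'u" where g: "inj g" "range g \<subseteq> A"
    using infinite_countable_subset by blast
  have "(\<Union>i\<in>range g. B (inv g i)) \<in> V"
    using A(1) g(2) V_subset assms by (intro V_UN) auto
  then show ?thesis using g(1) by simp
qed

lemma V_insert: "A \<in> V \<Longrightarrow> insert x A \<in> V"
proof -
  assume "A \<in> V"
  \<comment> \<open>The union of two sets is taken as that of the sequence {x}, A, A, ..., since V
    is closed under unions of indexed families.\<close>
  then have "(\<Union>n::nat. if n = 0 then {x} else A) \<in> V"
    using V_singleton by (intro V_countable_UN) simp
  moreover have "insert x A \<subseteq> (\<Union>n::nat. if n = 0 then {x} else A)"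
    by (auto intro: exI[of _ 1] exI[of _ 0])
  ultimately show ?thesis by (rule V_subset)
qed

lemma V_finite: "finite A \<Longrightarrow> A \<in> V"
  by (induction rule: finite_induct) (auto simp: V_empty V_insert)

text \<open>Functions from S to X are not elements of \<open>'u\<close>, so the size of this
  function set is expressed through an encoding \<open>h\<close>. The induction is over all
  \<open>h\<close> at once, because fixing the value at the new argument changes
  \<open>h\<close>.\<close>

lemma V_image_PiE:
  fixes h :: "('i \<Rightarrow> 'u) \<Rightarrow> 'u"
  assumes "finite S" "X \<in> V"
  shows "h ` (S \<rightarrow>\<^sub>E X) \<in> V"
  using assms(1)
proof (induction S arbitrary: h rule: finite_induct)
  case empty
  then show ?case using V_singleton by simp
next
  case (insert s S)
  have "h ` (insert s S \<rightarrow>\<^sub>E X) = (\<Union>y\<in>X. (\<lambda>g. h (g(s := y))) ` (S \<rightarrow>\<^sub>E X))"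
    by (force simp: PiE_insert_eq image_image)
  then show ?case using insert.IH assms(2) V_UN by simp
qed

text \<open>As \<open>'u\<close> is infinite it is in bijection with itself minus a point
  \<open>y\<close>, which is left to code \<open>None\<close>.\<close>

lemma inj_opt_code: "inj (opt_code :: 'u option \<Rightarrow> 'u)"
proof -
  obtain g :: "'u \<Rightarrow> 'u" and y where "bij_betw g UNIV (UNIV - {y})"
    using infinite_imp_bij_betw[OF infinite_UNIV] by blast
  then have g: "inj g" "g x \<noteq> y" for x
    by (simp_all only: bij_betw_def) (metis DiffE rangeI singletonI)
  have "inj (case_option y g)"
  proof (rule injI)
    fix a b assume "case_option y g a = case_option y g b"
    then show "a = b"
      by (simp add: inj_eq[OF g(1)] g(2) g(2)[symmetric] split: option.splits)
  qed
  then show ?thesis unfolding opt_code_def by (rule someI[of inj])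
qed

end

lemma PiE_ext_iff:
  assumes "f \<in> A \<rightarrow>\<^sub>E B" "g \<in> A \<rightarrow>\<^sub>E C"
  shows "f = g \<longleftrightarrow> (\<forall>x\<in>A. f x = g x)"
  using extensionalityI[of f A g] assms by (auto simp: PiE_def)

text \<open>Points are maps from a singleton, and V contains singletons; hence cancellation against
  all maps gives cancellation of points.\<close>

lemma (in universe) mono_SET_iff:
  "is_mono (SET V) a b f \<longleftrightarrow> a \<in> V \<and> b \<in> V \<and> f \<in> a \<rightarrow>\<^sub>E b \<and> inj_on f a"
proof
  assume m: "is_mono (SET V) a b f"
  then have a: "a \<in> V" "b \<in> V" and f: "f \<in> a \<rightarrow>\<^sub>E b" by (auto simp: is_mono_def)
  have "x = y" if "x \<in> a" "y \<in> a" "f x = f y" for x y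
  proof -
    have "(\<lambda>z\<in>{x}. x) \<in> {x} \<rightarrow>\<^sub>E a" "(\<lambda>z\<in>{x}. y) \<in> {x} \<rightarrow>\<^sub>E a"
      using that by auto
    moreover have "compose {x} f (\<lambda>z\<in>{x}. x) = compose {x} f (\<lambda>z\<in>{x}. y)"
      using that by (auto simp: compose_def restrict_def)
    ultimately have "(\<lambda>z\<in>{x}. x) = (\<lambda>z\<in>{x}. y)"
      using m V_singleton[of x] unfolding is_mono_def SET_sel by blast
    then show ?thesis by (metis restrict_apply' singletonI)
  qed
  then show "a \<in> V \<and> b \<in> V \<and> f \<in> a \<rightarrow>\<^sub>E b \<and> inj_on f a"
    using a f by (auto intro: inj_onI)
next
  assume m: "a \<in> V \<and> b \<in> V \<and> f \<in> a \<rightarrow>\<^sub>E b \<and> inj_on f a"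
  have "g = h" if "g \<in> c \<rightarrow>\<^sub>E a" "h \<in> c \<rightarrow>\<^sub>E a" "compose c f g = compose c f h" for c g h
  proof (rule PiE_ext[OF that(1,2)])
    fix x assume x: "x \<in> c"
    then have "f (g x) = f (h x)" using that(3) by (metis compose_eq)
    then show "g x = h x" using m that x by (meson PiE_mem inj_onD)
  qed
  then show "is_mono (SET V) a b f" using m by (auto simp: is_mono_def)
qed

text \<open>The universal property at a singleton is the unique existence of a point of
  \<open>p\<close> over each matching pair. Conversely these points, picked by \<open>THE\<close>,
  assemble into the mediating map.\<close>

lemma (in universe) pullback_SET_iff:
  "is_pullback (SET V) p a b c q r f g \<longleftrightarrow>
    p \<in> V \<and> a \<in> V \<and> b \<in> V \<and> c \<in> V \<and>
    q \<in> p \<rightarrow>\<^sub>E a \<and> r \<in> p \<rightarrow>\<^sub>E b \<and> f \<in> a \<rightarrow>\<^sub>E c \<and> g \<in> b \<rightarrow>\<^sub>E c \<and>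
    (\<forall>w\<in>p. f (q w) = g (r w)) \<and>
    (\<forall>u\<in>a. \<forall>v\<in>b. f u = g v \<longrightarrow> (\<exists>!w. w \<in> p \<and> q w = u \<and> r w = v))"
  (is "?pb \<longleftrightarrow> ?obj \<and> _ \<and> _ \<and> _ \<and> ?q \<and> ?r \<and> ?f \<and> ?g \<and> ?comm \<and> ?univ")
proof (cases "?obj \<and> a \<in> V \<and> b \<in> V \<and> c \<in> V \<and> ?q \<and> ?r \<and> ?f \<and> ?g")
  case False
  then show ?thesis by (auto simp: is_pullback_def)
next
  case True
  then have q: ?q and r: ?r and f: ?f and g: ?g and p: ?obj by auto
  have comm: "compose p f q = compose p g r \<longleftrightarrow> ?comm"
    using PiE_ext_iff[OF compose_PiE[OF q f] compose_PiE[OF r g]] by (simp add: compose_eq)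
  have "?univ" if pb: "?pb"
  proof (intro ballI impI)
    fix u v assume u: "u \<in> a" and v: "v \<in> b" and uv: "f u = g v"
    have "{u} \<in> V" by (rule V_singleton)
    moreover have "(\<lambda>_\<in>{u}. u) \<in> {u} \<rightarrow>\<^sub>E a" "(\<lambda>_\<in>{u}. v) \<in> {u} \<rightarrow>\<^sub>E b" using u v by auto
    moreover have "compose {u} f (\<lambda>_\<in>{u}. u) = compose {u} g (\<lambda>_\<in>{u}. v)"
      using uv by (auto simp: compose_def restrict_def)
    ultimately have ex1: "\<exists>!w. w \<in> {u} \<rightarrow>\<^sub>E p \<and> compose {u} q w = (\<lambda>_\<in>{u}. u) \<and>
        compose {u} r w = (\<lambda>_\<in>{u}. v)"
      using pb unfolding is_pullback_def SET_sel by blast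
    have iff: "w \<in> p \<and> q w = u \<and> r w = v \<longleftrightarrow> (\<lambda>_\<in>{u}. w) \<in> {u} \<rightarrow>\<^sub>E p \<and>
      compose {u} q (\<lambda>_\<in>{u}. w) = (\<lambda>_\<in>{u}. u) \<and> compose {u} r (\<lambda>_\<in>{u}. w) = (\<lambda>_\<in>{u}. v)" for w
      by (simp add: restrict_PiE_iff) (auto simp: compose_def restrict_def fun_eq_iff)
    obtain w where w: "w \<in> {u} \<rightarrow>\<^sub>E p" "compose {u} q w = (\<lambda>_\<in>{u}. u)"
      "compose {u} r w = (\<lambda>_\<in>{u}. v)" using ex1 by blast
    have weq: "w = (\<lambda>_\<in>{u}. w u)" by (rule PiE_ext[OF w(1)]) (use w in auto)
    show "\<exists>!w. w \<in> p \<and> q w = u \<and> r w = v"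
    proof (rule ex1I[of _ "w u"])
      show "w u \<in> p \<and> q (w u) = u \<and> r (w u) = v"
        unfolding iff using w weq by metis
      fix w' assume "w' \<in> p \<and> q w' = u \<and> r w' = v"
      then have "(\<lambda>_\<in>{u}. w') = w" unfolding iff using ex1 w by blast
      then show "w' = w u" by auto
    qed
  qed
  moreover have "?pb" if comm': "?comm" and univ: "?univ"
  proof -
    have main: "\<exists>!w. w \<in> z \<rightarrow>\<^sub>E p \<and> compose z q w = u \<and> compose z r w = v"
      if u: "u \<in> z \<rightarrow>\<^sub>E a" and v: "v \<in> z \<rightarrow>\<^sub>E b" and uv: "compose z f u = compose z g v" for z u v
    proof -
      have ex1: "\<exists>!w. w \<in> p \<and> q w = u x \<and> r w = v x" if "x \<in> z" for x
      proof -
        have "u x \<in> a" "v x \<in> b" "f (u x) = g (v x)"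
          using that u v fun_cong[OF uv, of x] by (auto simp: compose_eq)
        then show ?thesis using univ by blast
      qed
      define w where "w = (\<lambda>x\<in>z. THE w. w \<in> p \<and> q w = u x \<and> r w = v x)"
      have w: "w x \<in> p \<and> q (w x) = u x \<and> r (w x) = v x" if "x \<in> z" for x
        using theI'[OF ex1[OF that]] that by (simp add: w_def)
      show ?thesis
      proof (rule ex1I[of _ w])
        have wp: "w \<in> z \<rightarrow>\<^sub>E p" using w by (auto simp: w_def)
        moreover have "compose z q w = u"
          by (rule PiE_ext[OF compose_PiE[OF wp q] u]) (simp add: compose_eq w)
        moreover have "compose z r w = v"
          by (rule PiE_ext[OF compose_PiE[OF wp r] v]) (simp add: compose_eq w)
        ultimately show "w \<in> z \<rightarrow>\<^sub>E p \<and> compose z q w = u \<and> compose z r w = v" by simp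
        fix w' assume w': "w' \<in> z \<rightarrow>\<^sub>E p \<and> compose z q w' = u \<and> compose z r w' = v"
        show "w' = w"
        proof (rule PiE_ext[of _ z "\<lambda>_. p"])
          fix x assume x: "x \<in> z"
          then have "w' x \<in> p \<and> q (w' x) = u x \<and> r (w' x) = v x"
            using w' by (auto simp: compose_eq)
          then show "w' x = w x" using w[OF x] ex1[OF x] by blast
        qed (use w' wp in auto)
      qed
    qed
    show ?thesis
      using True comm comm' unfolding is_pullback_def SET_sel
      by (intro conjI ballI impI main) simp_all
  qed
  moreover have "?comm" if "?pb" using that comm by (simp add: is_pullback_def)
  ultimately show ?thesis using True by blast
qed

text \<open>When \<open>g\<close> is injective the component in \<open>b\<close> is determined by
  commutativity. Uniqueness of points of \<open>p\<close> then amounts to injectivity of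
  \<open>q\<close>, and existence to the condition on its image.\<close>

lemma (in universe) pullback_SET_mono_iff:
  assumes "inj_on g b"
  shows "is_pullback (SET V) p a b c q r f g \<longleftrightarrow>
    p \<in> V \<and> a \<in> V \<and> b \<in> V \<and> c \<in> V \<and>
    q \<in> p \<rightarrow>\<^sub>E a \<and> r \<in> p \<rightarrow>\<^sub>E b \<and> f \<in> a \<rightarrow>\<^sub>E c \<and> g \<in> b \<rightarrow>\<^sub>E c \<and>
    (\<forall>w\<in>p. f (q w) = g (r w)) \<and> inj_on q p \<and> (\<forall>u\<in>a. f u \<in> g ` b \<longrightarrow> u \<in> q ` p)"
  (is "?L = ?R")
proof
  assume L: ?L
  have "inj_on q p"
  proof (rule inj_onI)
    fix x y assume xy: "x \<in> p" "y \<in> p" "q x = q y"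
    then have "g (r x) = g (r y)" "r x \<in> b" "r y \<in> b" "q y \<in> a" "f (q y) = g (r y)"
      using L unfolding pullback_SET_iff by (metis PiE_mem)+
    then have "\<exists>!w. w \<in> p \<and> q w = q y \<and> r w = r y" "r x = r y"
      using L inj_onD[OF assms] unfolding pullback_SET_iff by blast+
    then show "x = y" using xy by blast
  qed
  then show ?R using L unfolding pullback_SET_iff by blast
next
  assume R: ?R
  have "\<exists>!w. w \<in> p \<and> q w = u \<and> r w = v" if uv: "u \<in> a" "v \<in> b" "f u = g v" for u v
  proof -
    have "u \<in> q ` p" using R uv by auto
    then obtain w where w: "w \<in> p" "q w = u" by blast
    have "g (r w) = g v" "r w \<in> b" using R w uv(3) by auto
    then have "r w = v" using inj_onD[OF assms] uv(2) by blast
    moreover have "inj_on q p" using R by blast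
    ultimately show ?thesis using w by (auto dest: inj_onD)
  qed
  then have "\<forall>u\<in>a. \<forall>v\<in>b. f u = g v \<longrightarrow> (\<exists>!w. w \<in> p \<and> q w = u \<and> r w = v)"
    by (intro ballI impI)
  then show ?L using R unfolding pullback_SET_iff by (elim conjE) (intro conjI; assumption)
qed


lemma (in universe) iso_SETI:
  assumes "a \<in> V" "b \<in> V" "f \<in> a \<rightarrow>\<^sub>E b" "bij_betw f a b"
  shows "is_iso (SET V) a b f"
proof -
  let ?g = "restrict (inv_into a f) b"
  have "compose a ?g f = (\<lambda>x\<in>a. x)" "compose b f ?g = (\<lambda>x\<in>b. x)"
    using assms by (auto simp: compose_def fun_eq_iff restrict_def bij_betw_inv_into_left
        bij_betw_inv_into_right bij_betwE)
  moreover have "?g \<in> b \<rightarrow>\<^sub>E a" using assms(4) by (auto simp: bij_betw_def inv_into_into)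
  ultimately show ?thesis using assms unfolding is_iso_def SET_sel by blast
qed

subsection \<open>Iterated differences\<close>

text \<open>For a subset S of X, these are the elements of F(X) that come from S. Images of all
  other maps reduce to these by \<open>image_fm\<close>.\<close>

definition img :: "'u set_functor \<Rightarrow> 'u set \<Rightarrow> 'u set \<Rightarrow> 'u set" where
  "img F X S = fm F S X (\<lambda>x\<in>S. x) ` fo F S"

abbreviation shift :: "'u \<Rightarrow> 'u" where
  "shift x \<equiv> opt_code (Some x)"

text \<open>Adjoining a point to X shifts X and puts \<open>opt_code None\<close> in front, so after
  n rounds the adjoined points are the first n of one fixed sequence. The finite cardinals are its
  initial segments.\<close>

definition point :: "nat \<Rightarrow> 'u" where
  "point i = (shift ^^ i) (opt_code None)"

lemma plus_one_funpow: "(plus_one ^^ n) X = point ` {..<n} \<union> (shift ^^ n) ` X"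
proof (induction n)
  case (Suc n)
  have points: "point ` {..<Suc n} = insert (opt_code None) (shift ` point ` {..<n})"
    by (simp add: lessThan_Suc_eq_insert_0 image_image point_def)
  have "(plus_one ^^ Suc n) X = insert (opt_code None) (shift ` (plus_one ^^ n) X)"
    by (simp add: plus_one_def image_image)
  also have "\<dots> = point ` {..<Suc n} \<union> (shift ^^ Suc n) ` X"
    unfolding points by (simp only: Suc.IH image_Un image_image funpow.simps comp_def Un_insert_left)
  finally show ?case .
qed simp

lemma fincard_eq: "fincard n = point ` {..<n}"
  by (simp add: fincard_def plus_one_funpow)

lemma finite_fincard: "finite (fincard n)"
  by (simp add: fincard_eq)

text \<open>The n-fold sum f + 1 + ... + 1. The recursion matches the unfolding of
  \<open>difference V ^^ Suc n\<close> from the outside, where the outermost difference evaluates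
  the n-th one at \<open>plus_one X\<close>.\<close>

primrec plus_map :: "nat \<Rightarrow> 'u set \<Rightarrow> ('u \<Rightarrow> 'u) \<Rightarrow> 'u \<Rightarrow> 'u" where
  "plus_map 0 X f = f"
| "plus_map (Suc n) X f = plus_map n (plus_one X) (plus_one_map X f)"

lemma Surj_hom_PiE: "f \<in> Hom Surj m n \<Longrightarrow> f \<in> fincard m \<rightarrow>\<^sub>E fincard n"
  by simp

context universe
begin

lemma V_fincard: "fincard n \<in> V"
  by (rule V_finite[OF finite_fincard])

lemma inj_shift: "inj (\<lambda>x::'u. shift x)"
  using inj_opt_code by (auto simp: inj_def)

lemma inj_shift_funpow: "inj ((\<lambda>x::'u. shift x) ^^ n)"
  by (rule inj_fn[OF inj_shift])

lemma None_neq_shift: "opt_code None \<noteq> (shift x :: 'u)"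
  using inj_opt_code by (auto simp: inj_def)

text \<open>Cancelling i common shifts would leave \<open>opt_code None\<close> equal to a shifted
  element.\<close>

lemma point_neq_shift: "i < n \<Longrightarrow> point i \<noteq> (shift ^^ n) (x :: 'u)"
proof
  assume "i < n" and eq: "point i = (shift ^^ n) x"
  then obtain k where n: "n = i + Suc k" using less_iff_Suc_add by auto
  have "(shift ^^ n) x = (shift ^^ i) (shift ((shift ^^ k) x))"
    unfolding n funpow_add by simp
  then have "opt_code None = shift ((shift ^^ k) x)"
    using eq injD[OF inj_shift_funpow[of i]] by (auto simp: point_def)
  then show False using None_neq_shift by blast
qed

lemma inj_point: "inj (point :: nat \<Rightarrow> 'u)"
proof (rule linorder_injI)
  fix i n :: nat assume "i < n"
  then show "point i \<noteq> (point n :: 'u)" using point_neq_shift[of i n] unfolding point_def[of n] by blast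
qed

lemma card_fincard: "card (fincard n :: 'u set) = n"
  unfolding fincard_eq by (subst card_image) (auto intro: inj_on_subset[OF inj_point])

lemma plus_one_map_None: "plus_one_map X f (opt_code None) = (opt_code None :: 'u)"
  by (simp add: plus_one_map_def plus_one_def inv_f_f[OF inj_opt_code])

lemma plus_one_map_shift: "x \<in> X \<Longrightarrow> plus_one_map X f (shift x) = (shift (f x) :: 'u)"
  by (simp add: plus_one_map_def plus_one_def inv_f_f[OF inj_opt_code])

lemma plus_one_map_PiE:
  fixes f :: "'u \<Rightarrow> 'u"
  assumes "f \<in> X \<rightarrow>\<^sub>E Y"
  shows "plus_one_map X f \<in> plus_one X \<rightarrow>\<^sub>E plus_one Y"
proof (rule PiE_I)
  fix z :: 'u assume "z \<in> plus_one X"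
  then consider "z = opt_code None" | x where "x \<in> X" "z = shift x"
    by (auto simp: plus_one_def)
  then show "plus_one_map X f z \<in> plus_one Y"
    using assms by cases (auto simp: plus_one_map_None plus_one_map_shift plus_one_def)
qed (simp add: plus_one_map_def)

lemma V_plus_one: "X \<in> V \<Longrightarrow> plus_one X \<in> V"
  unfolding plus_one_def by (simp add: image_image V_insert V_image)

lemma V_plus_one_funpow: "X \<in> V \<Longrightarrow> (plus_one ^^ n) X \<in> V"
  by (induction n) (simp_all add: V_plus_one)

lemma plus_map_PiE:
  "(f :: 'u \<Rightarrow> 'u) \<in> X \<rightarrow>\<^sub>E Y \<Longrightarrow> plus_map n X f \<in> (plus_one ^^ n) X \<rightarrow>\<^sub>E (plus_one ^^ n) Y"
proof (induction n arbitrary: X Y f)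
  case (Suc n)
  then show ?case
    using Suc.IH[OF plus_one_map_PiE[OF Suc.prems]] by (simp add: funpow_swap1)
qed simp

lemma plus_map_shift: "x \<in> X \<Longrightarrow> plus_map n X f ((shift ^^ n) x) = ((shift ^^ n) (f x) :: 'u)"
proof (induction n arbitrary: X f x)
  case (Suc n)
  have "shift x \<in> plus_one X" using Suc.prems by (simp add: plus_one_def)
  then show ?case
    using Suc.IH[of "shift x" "plus_one X" "plus_one_map X f"] Suc.prems
    by (simp add: funpow_swap1[where f = "\<lambda>x. shift x"] plus_one_map_shift)
qed simp

lemma plus_map_point: "i < n \<Longrightarrow> plus_map n X f (point i) = (point i :: 'u)"
proof (induction n arbitrary: X f)
  case (Suc n)
  show ?case
  proof (cases "i < n")
    case False
    \<comment> \<open>\<open>point n\<close> is the n-fold shift of the point adjoined to X itself,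
      which \<open>plus_one_map\<close> fixes.\<close>
    then have "i = n" using Suc.prems by simp
    then show ?thesis
      using plus_map_shift[of "opt_code None" "plus_one X" n "plus_one_map X f"]
      by (simp add: point_def plus_one_def plus_one_map_None)
  qed (simp add: Suc.IH)
qed simp

section \<open>Injective codes for the triples\<close>

lemma ex_inj_pair: "\<exists>p :: 'u \<times> 'u \<Rightarrow> 'u. inj p"
  using card_of_Times_same_infinite[OF infinite_UNIV]
  by (auto simp flip: card_of_ordIso simp: bij_betw_def)

text \<open>Only the values on S vary, and a pairing function on \<open>'u\<close> absorbs them one
  at a time.\<close>

lemma ex_inj_extensional:
  assumes "finite S"
  shows "\<exists>e :: ('i \<Rightarrow> 'u) \<Rightarrow> 'u. inj_on e (extensional S)"
  using assms
proof (induction S rule: finite_induct)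
  case empty
  then show ?case by (auto simp: inj_on_def)
next
  case (insert s S)
  then obtain e :: "('i \<Rightarrow> 'u) \<Rightarrow> 'u" where e: "inj_on e (extensional S)" by blast
  obtain p :: "'u \<times> 'u \<Rightarrow> 'u" where p: "inj p" using ex_inj_pair by blast
  have "inj_on (\<lambda>h. p (e (restrict h S), h s)) (extensional (insert s S))"
  proof (rule inj_onI)
    fix g h :: "'i \<Rightarrow> 'u"
    assume gh: "g \<in> extensional (insert s S)" "h \<in> extensional (insert s S)"
      and "p (e (restrict g S), g s) = p (e (restrict h S), h s)"
    then have s: "g s = h s" and "e (restrict g S) = e (restrict h S)"
      using p by (auto dest: injD)
    then have "restrict g S = restrict h S" using e by (auto dest: inj_onD)
    then have "g x = h x" if "x \<in> S" for x using that by (metis restrict_apply')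
    then show "g = h" using s gh by (intro extensionalityI[OF gh]) auto
  qed
  then show ?case by blast
qed

text \<open>\<open>triple_code\<close> is a choice, so some injection must be exhibited. Storing n
  as \<open>point n\<close> makes it recoverable, and with it the code \<open>e n\<close> under
  which \<open>x\<close> is stored.\<close>

lemma inj_on_triple_code:
  "inj_on triple_code {(n, x, a :: 'u). x \<in> extensional (fincard n)}"
proof -
  obtain p :: "'u \<times> 'u \<Rightarrow> 'u" where p: "inj p" using ex_inj_pair by blast
  have "\<forall>n. \<exists>e :: ('u \<Rightarrow> 'u) \<Rightarrow> 'u. inj_on e (extensional (fincard n))"
    using ex_inj_extensional[OF finite_fincard] by blast
  then obtain e :: "nat \<Rightarrow> ('u \<Rightarrow> 'u) \<Rightarrow> 'u" where e: "inj_on (e n) (extensional (fincard n))" for n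
    by metis
  have "inj_on (\<lambda>(n, x, a). p (point n, p (e n x, a))) {(n, x, a). x \<in> extensional (fincard n)}"
    using inj_eq[OF p] inj_eq[OF inj_point] inj_onD[OF e] by (auto intro!: inj_onI)
  then show ?thesis
    unfolding triple_code_def
    by (rule someI[of "\<lambda>e. inj_on e {(n, x, a). x \<in> extensional (fincard n)}"])
qed

section \<open>Images of subsets under a functor\<close>

lemma
  assumes F: "is_functor (SET V) (SET V) F"
  shows fo_V: "X \<in> V \<Longrightarrow> fo F X \<in> V"
    and fm_PiE: "X \<in> V \<Longrightarrow> Y \<in> V \<Longrightarrow> f \<in> X \<rightarrow>\<^sub>E Y \<Longrightarrow> fm F X Y f \<in> fo F X \<rightarrow>\<^sub>E fo F Y"
    and fm_id: "X \<in> V \<Longrightarrow> a \<in> fo F X \<Longrightarrow> fm F X X (\<lambda>x\<in>X. x) a = a"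
    and fm_comp: "X \<in> V \<Longrightarrow> Y \<in> V \<Longrightarrow> Z \<in> V \<Longrightarrow> f \<in> X \<rightarrow>\<^sub>E Y \<Longrightarrow> g \<in> Y \<rightarrow>\<^sub>E Z \<Longrightarrow> a \<in> fo F X \<Longrightarrow>
      fm F X Z (compose X g f) a = fm F Y Z g (fm F X Y f a)"
  using is_functorD[OF F] by (simp_all add: compose_eq)

lemma fm_mem:
  "is_functor (SET V) (SET V) F \<Longrightarrow> X \<in> V \<Longrightarrow> Y \<in> V \<Longrightarrow> f \<in> X \<rightarrow>\<^sub>E Y \<Longrightarrow> a \<in> fo F X \<Longrightarrow>
    fm F X Y f a \<in> fo F Y"
  using fm_PiE[of F X Y f] by auto

lemma img_mem: "is_functor (SET V) (SET V) F \<Longrightarrow> X \<in> V \<Longrightarrow> S \<subseteq> X \<Longrightarrow> a \<in> img F X S \<Longrightarrow> a \<in> fo F X"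
  unfolding img_def using fm_mem[OF _ V_subset[of X S] _ id_PiE] by auto

text \<open>The inclusion of S followed by \<open>f\<close> equals the restriction of
  \<open>f\<close> to a map from S to T followed by the inclusion of T.\<close>

lemma img_map:
  assumes F: "is_functor (SET V) (SET V) F" and V: "X \<in> V" "Y \<in> V"
    and f: "f \<in> X \<rightarrow>\<^sub>E Y" "S \<subseteq> X" "f ` S \<subseteq> T" "T \<subseteq> Y" and a: "a \<in> img F X S"
  shows "fm F X Y f a \<in> img F Y T"
proof -
  have ST: "S \<in> V" "T \<in> V" using V f V_subset by blast+
  obtain b where b: "b \<in> fo F S" "a = fm F S X (\<lambda>x\<in>S. x) b" using a by (auto simp: img_def)
  have r: "restrict f S \<in> S \<rightarrow>\<^sub>E T" using f by auto
  have "compose S f (\<lambda>x\<in>S. x) = compose S (\<lambda>x\<in>T. x) (restrict f S)"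
    using f by (auto simp: compose_def fun_eq_iff restrict_def)
  then have "fm F X Y f a = fm F T Y (\<lambda>x\<in>T. x) (fm F S T (restrict f S) b)"
    unfolding b(2) using fm_comp[OF F ST(1) V id_PiE[OF f(2)] f(1) b(1)]
      fm_comp[OF F ST(1,2) V(2) r id_PiE[OF f(4)] b(1)] by simp
  then show ?thesis unfolding img_def using fm_mem[OF F ST r b(1)] by blast
qed

lemma img_mono:
  assumes F: "is_functor (SET V) (SET V) F" and "X \<in> V" "S \<subseteq> T" "T \<subseteq> X" "a \<in> img F X S"
  shows "a \<in> img F X T"
  using img_map[of F X X "\<lambda>x\<in>X. x" S T a] assms fm_id[OF F] img_mem[OF F] by auto

text \<open>One half is \<open>img_map\<close>. For the other, choice gives a section of
  \<open>f\<close> over its image, so the inclusion of the image factors through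
  \<open>f\<close>.\<close>

lemma image_fm:
  assumes F: "is_functor (SET V) (SET V) F" and V: "X \<in> V" "Y \<in> V" and f: "f \<in> X \<rightarrow>\<^sub>E Y"
  shows "fm F X Y f ` fo F X = img F Y (f ` X)"
proof
  have sub: "f ` X \<subseteq> Y" using f by auto
  then have S: "f ` X \<in> V" using V V_subset by blast
  have "a \<in> img F X X" if "a \<in> fo F X" for a
    unfolding img_def using fm_id[OF F V(1) that] that by force
  then show "fm F X Y f ` fo F X \<subseteq> img F Y (f ` X)"
    using img_map[OF F V f subset_refl subset_refl sub] by blast
  show "img F Y (f ` X) \<subseteq> fm F X Y f ` fo F X"
  proof
    fix a assume "a \<in> img F Y (f ` X)"
    then obtain b where b: "b \<in> fo F (f ` X)" "a = fm F (f ` X) Y (\<lambda>x\<in>f ` X. x) b"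
      by (auto simp: img_def)
    let ?s = "restrict (inv_into X f) (f ` X)"
    have s: "?s \<in> f ` X \<rightarrow>\<^sub>E X" by (auto simp: inv_into_into)
    have "compose (f ` X) f ?s = (\<lambda>x\<in>f ` X. x)"
      by (auto simp: compose_def fun_eq_iff restrict_def f_inv_into_f)
    then have "a = fm F X Y f (fm F (f ` X) X ?s b)"
      unfolding b(2) using fm_comp[OF F S V s f b(1)] by simp
    then show "a \<in> fm F X Y f ` fo F X" using fm_mem[OF F S V(1) s b(1)] by blast
  qed
qed

section \<open>Values of the iterated differences\<close>

lemma fo_difference: "X \<in> V \<Longrightarrow> fo (difference V F) X = diff_obj F X"
  by (simp add: difference_def)

lemma fm_difference:
  "X \<in> V \<Longrightarrow> Y \<in> V \<Longrightarrow> f \<in> X \<rightarrow>\<^sub>E Y \<Longrightarrow> a \<in> diff_obj F X \<Longrightarrow>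
    fm (difference V F) X Y f a = fm F (plus_one X) (plus_one Y) (plus_one_map X f) a"
  by (simp add: difference_def)

text \<open>Only the new points, those of \<open>fincard n\<close>, may not be omitted by an element of the
  \<open>n\<close>-th difference at \<open>X\<close>.\<close>

lemma
  assumes F: "is_functor (SET V) (SET V) F"
  shows fo_difference_funpow: "X \<in> V \<Longrightarrow> fo ((difference V ^^ n) F) X =
      {a \<in> fo F ((plus_one ^^ n) X). \<forall>p\<in>fincard n. a \<notin> img F ((plus_one ^^ n) X) ((plus_one ^^ n) X - {p})}"
    and fm_difference_funpow: "X \<in> V \<Longrightarrow> Y \<in> V \<Longrightarrow> f \<in> X \<rightarrow>\<^sub>E Y \<Longrightarrow>
      a \<in> fo ((difference V ^^ n) F) X \<Longrightarrow>
      fm ((difference V ^^ n) F) X Y f a = fm F ((plus_one ^^ n) X) ((plus_one ^^ n) Y) (plus_map n X f) a"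
proof (induction n arbitrary: X Y f a)
  case 0
  { case 1 then show ?case by (simp add: fincard_eq) }
  { case 2 then show ?case by simp }
next
  case (Suc n)
  let ?D = "(difference V ^^ n) F"
  have obj: "fo ((difference V ^^ Suc n) F) X = diff_obj ?D X" if "X \<in> V" for X
    using that by (simp add: fo_difference)
  { case 1
    let ?Z = "(plus_one ^^ Suc n) X" and ?Y = "(plus_one ^^ n) X"
    \<comment> \<open>On its elements the n-th difference sends the injection of X into X + 1 to
      F(\<open>?j\<close>). The point adjoined to X sits in \<open>?Z\<close> as
      \<open>point n\<close>, and it is the only point outside the image of
      \<open>?j\<close>.\<close>
    let ?j = "plus_map n X (plus_one_inj X)" and ?q = "point n"
    have V: "plus_one X \<in> V" "?Y \<in> V" "?Z \<in> V" using 1 by (simp_all add: V_plus_one V_plus_one_funpow del: funpow.simps)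
    have Z: "(plus_one ^^ n) (plus_one X) = ?Z" by (simp add: funpow_swap1)
    have inj: "plus_one_inj X \<in> X \<rightarrow>\<^sub>E plus_one X" by (auto simp: plus_one_inj_def plus_one_def)
    have j: "?j \<in> ?Y \<rightarrow>\<^sub>E ?Z" using plus_map_PiE[OF inj, of n] unfolding Z .
    have jS: "?j ((shift ^^ n) x) = (shift ^^ Suc n) x" if "x \<in> X" for x
      using that by (simp add: plus_map_shift plus_one_inj_def funpow_swap1[where f = "\<lambda>x. shift x"])
    have img_j: "?j ` ?Y = ?Z - {?q}"
    proof -
      have "?j ` ?Y = point ` {..<n} \<union> (shift ^^ Suc n) ` X"
        unfolding plus_one_funpow[of n X] image_Un image_image
        by (intro arg_cong2[of _ _ _ _ "(\<union>)"] image_cong refl) (simp_all add: plus_map_point jS del: funpow.simps)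
      also have "\<dots> = ?Z - {?q}"
        unfolding plus_one_funpow[of "Suc n" X] lessThan_Suc
        using inj_eq[OF inj_point] point_neq_shift[of n "Suc n"] by (auto simp del: funpow.simps)
      finally show ?thesis .
    qed
    have D1: "fo ?D (plus_one X) = {a \<in> fo F ?Z. \<forall>p\<in>fincard n. a \<notin> img F ?Z (?Z - {p})}"
      using Suc.IH(1)[OF V(1)] unfolding Z .
    have D0: "fm ?D X (plus_one X) (plus_one_inj X) ` fo ?D X = fm F ?Y ?Z ?j ` fo ?D X"
      using Suc.IH(2)[OF 1 V(1) inj] unfolding Z by (intro image_cong) auto
    \<comment> \<open>What is subtracted is the image of the n-th difference at X, not that of all
      of F(\<open>?Y\<close>). Both have the same part inside the n-th difference at X + 1: an
      element whose image needs every point of \<open>fincard n\<close> needs them itself.\<close>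
    have "a \<in> fo ?D X" if a: "a \<in> fo F ?Y" "fm F ?Y ?Z ?j a \<in> fo ?D (plus_one X)" for a
    proof -
      have "a \<notin> img F ?Y (?Y - {p})" if p: "p \<in> fincard n" for p
      proof
        assume "a \<in> img F ?Y (?Y - {p})"
        \<comment> \<open>\<open>?j\<close> fixes the points of \<open>fincard n\<close> and sends
          the shifted copy of X to elements that are none of them.\<close>
        moreover have "?j ` (?Y - {p}) \<subseteq> ?Z - {p}"
        proof -
          obtain i where i: "p = point i" "i < n" using p by (auto simp: fincard_eq)
          have "?j y \<noteq> p" if "y \<in> ?Y" "y \<noteq> p" for y
          proof -
            consider k where "k < n" "y = point k" | x where "x \<in> X" "y = (shift ^^ n) x"
              using \<open>y \<in> ?Y\<close> unfolding plus_one_funpow by auto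
            then show ?thesis
              using i \<open>y \<noteq> p\<close> point_neq_shift[of i "Suc n"]
              by cases (simp_all add: plus_map_point jS del: funpow.simps, metis less_SucI)
          qed
          then show ?thesis using j by auto
        qed
        ultimately have "fm F ?Y ?Z ?j a \<in> img F ?Z (?Z - {p})"
          by (intro img_map[OF F V(2,3) j]) auto
        then show False using a(2) p unfolding D1 by blast
      qed
      then show ?thesis using Suc.IH(1)[OF 1] a(1) by blast
    qed
    moreover have "fo ?D X \<subseteq> fo F ?Y" using Suc.IH(1)[OF 1] by blast
    ultimately have "fo ?D (plus_one X) - fm F ?Y ?Z ?j ` fo ?D X
        = fo ?D (plus_one X) - fm F ?Y ?Z ?j ` fo F ?Y" by blast
    also have "\<dots> = fo ?D (plus_one X) - img F ?Z (?Z - {?q})"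
      using image_fm[OF F V(2,3) j] img_j by simp
    also have "\<dots> = {a \<in> fo F ?Z. \<forall>p\<in>fincard (Suc n). a \<notin> img F ?Z (?Z - {p})}"
      unfolding D1 fincard_eq lessThan_Suc by blast
    finally show ?case unfolding obj[OF 1] diff_obj_def D0 .
  next
    case 2
    have "a \<in> diff_obj ?D X" "a \<in> fo ?D (plus_one X)" using 2 obj[of X] by (auto simp: diff_obj_def)
    then show ?case using 2 Suc.IH(2)[of "plus_one X" "plus_one Y" "plus_one_map X f" a]
      by (simp add: fm_difference V_plus_one plus_one_map_PiE funpow_swap1[where f = plus_one])
  }
qed

text \<open>A proper subset misses some point p and so lies in the complement of p, and images grow
  with the subset. Omitting single points therefore tests all proper subsets.\<close>

lemma iter_diff_zero_iff:
  assumes F: "is_functor (SET V) (SET V) F"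
  shows "a \<in> iter_diff_zero V F n \<longleftrightarrow>
    a \<in> fo F (fincard n) \<and> (\<forall>S\<subseteq>fincard n. a \<in> img F (fincard n) S \<longrightarrow> S = fincard n)"
proof -
  have "a \<in> iter_diff_zero V F n \<longleftrightarrow>
      a \<in> fo F (fincard n) \<and> (\<forall>p\<in>fincard n. a \<notin> img F (fincard n) (fincard n - {p}))"
    unfolding iter_diff_zero_def fo_difference_funpow[OF F V_empty] fincard_def by simp
  moreover have "(\<forall>p\<in>fincard n. a \<notin> img F (fincard n) (fincard n - {p})) \<longleftrightarrow>
      (\<forall>S\<subseteq>fincard n. a \<in> img F (fincard n) S \<longrightarrow> S = fincard n)" (is "?P \<longleftrightarrow> ?Q")
  proof
    assume P: ?P
    show ?Q
    proof (intro allI impI)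
      fix S assume S: "S \<subseteq> fincard n" "a \<in> img F (fincard n) S"
      have "p \<in> S" if "p \<in> fincard n" for p
      proof (rule ccontr)
        assume "p \<notin> S"
        then have "S \<subseteq> fincard n - {p}" using S(1) by blast
        then have "a \<in> img F (fincard n) (fincard n - {p})"
          by (rule img_mono[OF F V_fincard _ _ S(2)]) blast
        then show False using P that by blast
      qed
      then show "S = fincard n" using S(1) by blast
    qed
  qed blast
  ultimately show ?thesis by simp
qed

end

subsection \<open>Taut functors\<close>

context universe
begin

lemma taut_functor_is_functor: "taut_functor C D F \<Longrightarrow> is_functor C D F"
  by (simp add: taut_functor_def)

text \<open>For injective \<open>f\<close> the square with two identities and \<open>f\<close> twice
  is a pullback along a monomorphism, and its preservation makes F(f) injective. A retraction of
  \<open>f\<close> would not exist when X is empty and Y is not.\<close>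

lemma taut_inj:
  assumes F: "taut_functor (SET V) (SET V) F" and V: "X \<in> V" "Y \<in> V"
    and f: "f \<in> X \<rightarrow>\<^sub>E Y" "inj_on f X"
  shows "inj_on (fm F X Y f) (fo F X)"
proof -
  let ?i = "\<lambda>x\<in>X. x"
  note F' = taut_functor_is_functor[OF F]
  have "is_pullback (SET V) X X X Y ?i ?i f f"
    unfolding pullback_SET_mono_iff[OF f(2)] using V f by (auto simp: inj_on_def)
  moreover have "is_mono (SET V) X Y f" using V f by (simp add: mono_SET_iff)
  ultimately have "is_pullback (SET V) (fo F X) (fo F X) (fo F X) (fo F Y) (fm F X X ?i) (fm F X X ?i)
      (fm F X Y f) (fm F X Y f)"
    using F unfolding taut_functor_def by blast
  then have "a = b"
    if "a \<in> fo F X" "b \<in> fo F X" "fm F X Y f a = fm F X Y f b" for a b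
    using that unfolding pullback_SET_iff by blast
  then show ?thesis by (intro inj_onI)
qed

text \<open>Preservation of the inverse image square of S along \<open>f\<close>, read on elements:
  an element of F(X) and one of F(S) that agree in F(Y) come from a common element of F at the
  preimage.\<close>

lemma taut_preimage:
  assumes F: "taut_functor (SET V) (SET V) F" and V: "X \<in> V" "Y \<in> V"
    and f: "f \<in> X \<rightarrow>\<^sub>E Y" and S: "S \<subseteq> Y" and a: "a \<in> fo F X" "fm F X Y f a \<in> img F Y S"
  shows "a \<in> img F X {x \<in> X. f x \<in> S}"
proof -
  let ?P = "{x \<in> X. f x \<in> S}"
  have SP: "S \<in> V" "?P \<in> V" using V S V_subset by auto
  have inj: "inj_on (\<lambda>x\<in>S. x) S" by (auto simp: inj_on_def)
  have "is_pullback (SET V) ?P X S Y (\<lambda>x\<in>?P. x) (restrict f ?P) f (\<lambda>x\<in>S. x)"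
    unfolding pullback_SET_mono_iff[OF inj] using V SP f S by (auto simp: inj_on_def)
  moreover have "is_mono (SET V) S Y (\<lambda>x\<in>S. x)" using V SP S inj by (auto simp: mono_SET_iff)
  ultimately have pb: "is_pullback (SET V) (fo F ?P) (fo F X) (fo F S) (fo F Y) (fm F ?P X (\<lambda>x\<in>?P. x))
      (fm F ?P S (restrict f ?P)) (fm F X Y f) (fm F S Y (\<lambda>x\<in>S. x))"
    using F unfolding taut_functor_def by blast
  obtain b where "b \<in> fo F S" "fm F X Y f a = fm F S Y (\<lambda>x\<in>S. x) b"
    using a(2) by (auto simp: img_def)
  then have "\<exists>w. w \<in> fo F ?P \<and> fm F ?P X (\<lambda>x\<in>?P. x) w = a"
    using pb a(1) unfolding pullback_SET_iff by blast
  then show ?thesis unfolding img_def by blast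
qed

text \<open>A pullback along a monomorphism \<open>g\<close> is an inverse image of a subset up to
  renaming: the image of \<open>g\<close> plays the part of S, and the image of \<open>q\<close> is
  its preimage under \<open>f\<close>.\<close>

lemma taut_functorI:
  assumes F: "is_functor (SET V) (SET V) F"
    and inj: "\<And>X Y f. X \<in> V \<Longrightarrow> Y \<in> V \<Longrightarrow> f \<in> X \<rightarrow>\<^sub>E Y \<Longrightarrow> inj_on f X \<Longrightarrow>
      inj_on (fm F X Y f) (fo F X)"
    and preimage: "\<And>X Y f S a. X \<in> V \<Longrightarrow> Y \<in> V \<Longrightarrow> f \<in> X \<rightarrow>\<^sub>E Y \<Longrightarrow> S \<subseteq> Y \<Longrightarrow>
      a \<in> fo F X \<Longrightarrow> fm F X Y f a \<in> img F Y S \<Longrightarrow> a \<in> img F X {x \<in> X. f x \<in> S}"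
  shows "taut_functor (SET V) (SET V) F"
proof -
  have "is_pullback (SET V) (fo F p) (fo F a) (fo F b) (fo F c) (fm F p a q) (fm F p b r)
      (fm F a c f) (fm F b c g)"
    if pb: "is_pullback (SET V) p a b c q r f g" and mono: "is_mono (SET V) b c g" for p a b c q r f g
  proof -
    have g: "inj_on g b" using mono by (simp add: mono_SET_iff)
    have V: "p \<in> V" "a \<in> V" "b \<in> V" "c \<in> V"
      and arr: "q \<in> p \<rightarrow>\<^sub>E a" "r \<in> p \<rightarrow>\<^sub>E b" "f \<in> a \<rightarrow>\<^sub>E c" "g \<in> b \<rightarrow>\<^sub>E c"
      and q: "inj_on q p" and pre: "\<forall>u\<in>a. f u \<in> g ` b \<longrightarrow> u \<in> q ` p"
      using pb unfolding pullback_SET_mono_iff[OF g] by simp_all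
    have comm: "compose p f q = compose p g r" using pb by (simp add: is_pullback_def)
    have "fm F a c f (fm F p a q w) = fm F b c g (fm F p b r w)" if "w \<in> fo F p" for w
      using fm_comp[OF F V(1,2,4) arr(1,3) that] fm_comp[OF F V(1,3,4) arr(2,4) that] comm by simp
    moreover have "u \<in> fm F p a q ` fo F p" if u: "u \<in> fo F a" "fm F a c f u \<in> fm F b c g ` fo F b" for u
    proof -
      have "g ` b \<subseteq> c" using arr by auto
      moreover have "fm F a c f u \<in> img F c (g ` b)" using u image_fm[OF F V(3,4) arr(4)] by simp
      ultimately have "u \<in> img F a {x \<in> a. f x \<in> g ` b}" using preimage V arr u by blast
      moreover have "{x \<in> a. f x \<in> g ` b} = q ` p"
      proof
        show "{x \<in> a. f x \<in> g ` b} \<subseteq> q ` p" using pre by blast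
        have "f (q w) = g (r w)" if "w \<in> p" for w
          using pb that unfolding pullback_SET_mono_iff[OF g] by simp
        then show "q ` p \<subseteq> {x \<in> a. f x \<in> g ` b}" using arr by auto
      qed
      ultimately show ?thesis using image_fm[OF F V(1,2) arr(1)] by simp
    qed
    ultimately show ?thesis
      unfolding pullback_SET_mono_iff[OF inj[OF V(3,4) arr(4) g]]
      using fo_V[OF F] V fm_PiE[OF F] arr inj[OF V(1,2) arr(1) q] by simp
  qed
  then show ?thesis unfolding taut_functor_def using F by blast
qed

lemma taut_trans_nat: "taut_trans C D F G t \<Longrightarrow> nat_trans C D F G t"
  by (simp add: taut_trans_def)

lemma nat_trans_mem:
  assumes "nat_trans (SET V) (SET V) F G t" "X \<in> V" "a \<in> fo F X"
  shows "t X a \<in> fo G X"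
  using nat_transD(4)[OF assms(1)] assms by auto

lemma nat_trans_natural:
  assumes "nat_trans (SET V) (SET V) F G t" "X \<in> V" "Y \<in> V" "f \<in> X \<rightarrow>\<^sub>E Y" "a \<in> fo F X"
  shows "t Y (fm F X Y f a) = fm G X Y f (t X a)"
  using fun_cong[OF nat_transD(5)[OF assms(1), of X Y f], of a] assms by (simp add: compose_eq)

lemma taut_trans_img:
  assumes t: "taut_trans (SET V) (SET V) F G t"
    and X: "X \<in> V" "S \<subseteq> X" and a: "a \<in> fo F X" "t X a \<in> img G X S"
  shows "a \<in> img F X S"
proof -
  have "S \<in> V" using X V_subset by blast
  then have "is_mono (SET V) S X (\<lambda>x\<in>S. x)" using X by (auto simp: mono_SET_iff inj_on_def)
  then have pb: "is_pullback (SET V) (fo F S) (fo F X) (fo G S) (fo G X) (fm F S X (\<lambda>x\<in>S. x)) (t S) (t X)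
      (fm G S X (\<lambda>x\<in>S. x))" using t unfolding taut_trans_def by blast
  obtain b where "b \<in> fo G S" "t X a = fm G S X (\<lambda>x\<in>S. x) b"
    using a(2) by (auto simp: img_def)
  then have "\<exists>w. w \<in> fo F S \<and> fm F S X (\<lambda>x\<in>S. x) w = a"
    using pb a(1) unfolding pullback_SET_iff by blast
  then show ?thesis unfolding img_def by blast
qed

text \<open>In the square at a monomorphism \<open>m\<close>, both F(m) and G(m) are injective by
  tautness of the functors. Of the pullback property only the condition on images is left, and
  \<open>image_fm\<close> reduces it to subsets.\<close>

lemma taut_transI:
  assumes F: "taut_functor (SET V) (SET V) F" and G: "taut_functor (SET V) (SET V) G"
    and t: "nat_trans (SET V) (SET V) F G t"
    and img: "\<And>X S a. X \<in> V \<Longrightarrow> S \<subseteq> X \<Longrightarrow> a \<in> fo F X \<Longrightarrow> t X a \<in> img G X S \<Longrightarrow> a \<in> img F X S"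
  shows "taut_trans (SET V) (SET V) F G t"
proof -
  note F' = taut_functor_is_functor[OF F] and G' = taut_functor_is_functor[OF G]
  have "is_pullback (SET V) (fo F a) (fo F b) (fo G a) (fo G b) (fm F a b m) (t a) (t b) (fm G a b m)"
    if "is_mono (SET V) a b m" for a b m
  proof -
    have V: "a \<in> V" "b \<in> V" and m: "m \<in> a \<rightarrow>\<^sub>E b" "inj_on m a" using that by (simp_all add: mono_SET_iff)
    have "m ` a \<subseteq> b" using m by auto
    then have "u \<in> fm F a b m ` fo F a" if "u \<in> fo F b" "t b u \<in> fm G a b m ` fo G a" for u
      using that img[OF V(2)] image_fm[OF F' V m(1)] image_fm[OF G' V m(1)] by simp
    then show ?thesis
      unfolding pullback_SET_mono_iff[OF taut_inj[OF G V m]]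
      using fo_V[OF F'] fo_V[OF G'] V fm_PiE[OF F' V m(1)] fm_PiE[OF G' V m(1)]
        nat_transD(4)[OF t] nat_trans_natural[OF t V m(1)] taut_inj[OF F V m] by simp
  qed
  then show ?thesis unfolding taut_trans_def using t by blast
qed

lemma taut_trans_id:
  assumes F: "taut_functor (SET V) (SET V) F"
  shows "taut_trans (SET V) (SET V) F F (trans_id (SET V) (SET V) F)"
  by (rule taut_transI[OF F F nat_trans_id[OF taut_functor_is_functor[OF F]]])
     (simp add: trans_id_def)

lemma taut_trans_comp:
  assumes F: "taut_functor (SET V) (SET V) F" and H: "taut_functor (SET V) (SET V) H"
    and t: "taut_trans (SET V) (SET V) F G t" and s: "taut_trans (SET V) (SET V) G H s"
  shows "taut_trans (SET V) (SET V) F H (trans_comp (SET V) (SET V) F G H s t)"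
  by (rule taut_transI[OF F H nat_trans_comp[OF taut_trans_nat[OF t] taut_trans_nat[OF s]]])
     (auto simp: trans_comp_def compose_eq
       intro: taut_trans_img[OF t] taut_trans_img[OF s] nat_trans_mem[OF taut_trans_nat[OF t]])

lemma category_Taut: "is_category (Taut V)"
  unfolding is_category_def
  by (simp add: taut_trans_id taut_trans_comp trans_comp_id[OF taut_trans_nat]
      trans_comp_assoc[OF taut_trans_nat taut_trans_nat taut_trans_nat])

section \<open>Iterated differences as a functor to soft species\<close>

text \<open>If F(f) a comes from S, tautness brings \<open>a\<close> from the preimage of S, which
  then has to be everything. So S contains the image of \<open>f\<close>, and that is all of
  \<open>fincard n\<close>.\<close>

lemma diff_surj:
  assumes F: "taut_functor (SET V) (SET V) F" and f: "f \<in> Hom Surj m n"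
    and a: "a \<in> iter_diff_zero V F m"
  shows "fm F (fincard m) (fincard n) f a \<in> iter_diff_zero V F n"
proof -
  note F' = taut_functor_is_functor[OF F]
  note f' = Surj_hom_PiE[OF f]
  have am: "a \<in> fo F (fincard m)" using a iter_diff_zero_iff[OF F'] by blast
  have "S = fincard n" if S: "S \<subseteq> fincard n" "fm F (fincard m) (fincard n) f a \<in> img F (fincard n) S" for S
  proof -
    have "a \<in> img F (fincard m) {x \<in> fincard m. f x \<in> S}"
      by (rule taut_preimage[OF F V_fincard V_fincard f' S(1) am S(2)])
    moreover have "{x \<in> fincard m. f x \<in> S} \<subseteq> fincard m" by (rule Collect_restrict)
    ultimately have "{x \<in> fincard m. f x \<in> S} = fincard m"
      using a by (simp only: iter_diff_zero_iff[OF F'])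
    then have "f ` fincard m \<subseteq> S" by blast
    then show ?thesis using f S(1) by simp
  qed
  then show ?thesis
    unfolding iter_diff_zero_iff[OF F'] using fm_mem[OF F' V_fincard V_fincard f' am] by blast
qed

text \<open>By \<open>taut_trans_img\<close>, the image of \<open>a\<close> under \<open>t\<close>
  comes from a subset only if \<open>a\<close> itself does.\<close>

lemma diff_trans:
  assumes F: "is_functor (SET V) (SET V) F" and G: "is_functor (SET V) (SET V) G"
    and t: "taut_trans (SET V) (SET V) F G t"
    and a: "a \<in> iter_diff_zero V F n"
  shows "t (fincard n) a \<in> iter_diff_zero V G n"
  using a nat_trans_mem[OF taut_trans_nat[OF t] V_fincard]
    taut_trans_img[OF t V_fincard] unfolding iter_diff_zero_iff[OF F] iter_diff_zero_iff[OF G]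
  by blast

lemma V_iter_diff_zero: "is_functor (SET V) (SET V) F \<Longrightarrow> iter_diff_zero V F n \<in> V"
  using iter_diff_zero_iff V_subset[OF fo_V[OF _ V_fincard]] by (metis subsetI)

lemma fo_diff_star: "fo (diff_star V F) n = iter_diff_zero V F n"
  by (simp add: diff_star_def)

lemma fm_diff_star:
  "f \<in> Hom Surj m n \<Longrightarrow>
    fm (diff_star V F) m n f = restrict (fm F (fincard m) (fincard n) f) (iter_diff_zero V F m)"
  by (simp add: diff_star_def)

lemma functor_diff_star:
  assumes F: "taut_functor (SET V) (SET V) F"
  shows "is_functor Surj (SET V) (diff_star V F)"
  unfolding diff_star_def
proof (rule is_functor_ftor_onI[OF category_Surj category_SET])
  note F' = taut_functor_is_functor[OF F]
  show "iter_diff_zero V F n \<in> Obj (SET V)" for n using V_iter_diff_zero[OF F'] by simp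
  show "restrict (fm F (fincard m) (fincard n) f) (iter_diff_zero V F m)
      \<in> Hom (SET V) (iter_diff_zero V F m) (iter_diff_zero V F n)" if "f \<in> Hom Surj m n" for m n f
    using diff_surj[OF F that] by auto
  show "restrict (fm F (fincard n) (fincard n) (Ide Surj n)) (iter_diff_zero V F n)
      = Ide (SET V) (iter_diff_zero V F n)" for n
    unfolding Surj_sel SET_sel
    by (rule restrict_ext) (simp add: iter_diff_zero_iff[OF F'] fm_id[OF F' V_fincard])
  show "restrict (fm F (fincard a) (fincard c) (Comp Surj a b c g f)) (iter_diff_zero V F a) =
      Comp (SET V) (iter_diff_zero V F a) (iter_diff_zero V F b) (iter_diff_zero V F c)
        (restrict (fm F (fincard b) (fincard c) g) (iter_diff_zero V F b))
        (restrict (fm F (fincard a) (fincard b) f) (iter_diff_zero V F a))"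
    if f: "f \<in> Hom Surj a b" and g: "g \<in> Hom Surj b c" for a b c f g
    using diff_surj[OF F f] iter_diff_zero_iff[OF F']
      fm_comp[OF F' V_fincard V_fincard V_fincard Surj_hom_PiE[OF f] Surj_hom_PiE[OF g]]
    by (auto simp: compose_def fun_eq_iff restrict_def)
qed

lemma nat_trans_diff_star_trans:
  assumes F: "taut_functor (SET V) (SET V) F" and G: "taut_functor (SET V) (SET V) G"
    and t: "taut_trans (SET V) (SET V) F G t"
  shows "nat_trans Surj (SET V) (diff_star V F) (diff_star V G) (diff_star_trans V F G t)"
proof -
  note F' = taut_functor_is_functor[OF F] and G' = taut_functor_is_functor[OF G]
  have "diff_star_trans V F G t n \<in> iter_diff_zero V F n \<rightarrow>\<^sub>E iter_diff_zero V G n" for n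
    using diff_trans[OF F' G' t] by (auto simp: diff_star_trans_def)
  moreover have "compose (iter_diff_zero V F m) (diff_star_trans V F G t n) (fm (diff_star V F) m n f)
      = compose (iter_diff_zero V F m) (fm (diff_star V G) m n f) (diff_star_trans V F G t m)"
    if f: "f \<in> Hom Surj m n" for m n f
    using diff_surj[OF F f] diff_trans[OF F' G' t] iter_diff_zero_iff[OF F']
      nat_trans_natural[OF taut_trans_nat[OF t] V_fincard V_fincard Surj_hom_PiE[OF f]]
    by (auto simp: compose_def fun_eq_iff restrict_def diff_star_trans_def fm_diff_star[OF f])
  ultimately show ?thesis
    unfolding nat_trans_def using functor_diff_star[OF F] functor_diff_star[OF G]
    by (simp add: fo_diff_star del: Surj_sel(2))
qed

lemma functor_DeltaStar: "is_functor (Taut V) (SoftSp V) (DeltaStar V)"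
  unfolding DeltaStar_def
proof (rule is_functor_ftor_onI[OF category_Taut category_SoftSp])
  fix F assume "F \<in> Obj (Taut V)"
  then have F: "taut_functor (SET V) (SET V) F" by simp
  note F' = taut_functor_is_functor[OF F]
  show "diff_star V F \<in> Obj (SoftSp V)" using functor_diff_star[OF F] by simp
  show "diff_star_trans V F F (Ide (Taut V) F) = Ide (SoftSp V) (diff_star V F)"
    using iter_diff_zero_iff[OF F']
    by (auto simp: fun_eq_iff restrict_def diff_star_trans_def trans_id_def fo_diff_star V_fincard)
next
  fix F G t assume "F \<in> Obj (Taut V)" "G \<in> Obj (Taut V)" "t \<in> Hom (Taut V) F G"
  then show "diff_star_trans V F G t \<in> Hom (SoftSp V) (diff_star V F) (diff_star V G)"
    by (simp add: nat_trans_diff_star_trans)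
next
  fix F G H t s
  assume "F \<in> Obj (Taut V)" "G \<in> Obj (Taut V)" "H \<in> Obj (Taut V)"
    "t \<in> Hom (Taut V) F G" "s \<in> Hom (Taut V) G H"
  then have F: "is_functor (SET V) (SET V) F" and G: "is_functor (SET V) (SET V) G"
    and t: "taut_trans (SET V) (SET V) F G t" by (simp_all add: taut_functor_def)
  show "diff_star_trans V F H (Comp (Taut V) F G H s t) =
    Comp (SoftSp V) (diff_star V F) (diff_star V G) (diff_star V H)
      (diff_star_trans V G H s) (diff_star_trans V F G t)"
    using iter_diff_zero_iff[OF F] diff_trans[OF F G t]
    by (auto simp: fun_eq_iff restrict_def diff_star_trans_def trans_comp_def fo_diff_star V_fincard
        compose_def)
qed

end

subsection \<open>Newton sums\<close>

text \<open>The numbering depends on S alone, so that the pushed-forward elements of triples with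
  equal images can be compared.\<close>

definition chart :: "'u set \<Rightarrow> 'u \<Rightarrow> 'u" where
  "chart S = restrict (SOME c. bij_betw c S (fincard (card S))) S"

text \<open>
  A complete invariant for the coend relation: \<open>(n, x, a)\<close> is pushed forward along the
  surjection of \<open>n\<close> onto the image of \<open>x\<close>.  It does not mention the set \<open>X\<close> in which
  \<open>x\<close> takes its values.
\<close>

definition newton_nf :: "'u soft_species \<Rightarrow> nat \<times> ('u \<Rightarrow> 'u) \<times> 'u \<Rightarrow> 'u set \<times> 'u" where
  "newton_nf G = (\<lambda>(n, x, a). let S = x ` fincard n in
     (S, fm G n (card S) (compose (fincard n) (chart S) x) a))"

lemma newton_nf_image: "newton_nf G (n, x, a) = newton_nf H (l, y, b) \<Longrightarrow> x ` fincard n = y ` fincard l"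
  by (simp add: newton_nf_def Let_def)

context universe
begin

lemma
  assumes G: "is_functor Surj (SET V) G"
  shows sp_V: "fo G n \<in> V"
    and sp_PiE: "f \<in> Hom Surj m n \<Longrightarrow> fm G m n f \<in> fo G m \<rightarrow>\<^sub>E fo G n"
    and sp_mem: "f \<in> Hom Surj m n \<Longrightarrow> a \<in> fo G m \<Longrightarrow> fm G m n f a \<in> fo G n"
    and sp_id: "a \<in> fo G n \<Longrightarrow> fm G n n (\<lambda>x\<in>fincard n. x) a = a"
    and sp_comp: "f \<in> Hom Surj m n \<Longrightarrow> g \<in> Hom Surj n k \<Longrightarrow> a \<in> fo G m \<Longrightarrow>
      fm G m k (compose (fincard m) g f) a = fm G n k g (fm G m n f a)"
proof -
  show PiE: "fm G m n f \<in> fo G m \<rightarrow>\<^sub>E fo G n" if "f \<in> Hom Surj m n" for m n f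
    using is_functorD(2)[OF G, of m n f] that by simp
  then show "fm G m n f a \<in> fo G n" if "f \<in> Hom Surj m n" "a \<in> fo G m"
    using PiE_mem that by metis
  show "fo G n \<in> V" using is_functorD(1)[OF G, of n] by simp
  show "fm G n n (\<lambda>x\<in>fincard n. x) a = a" if "a \<in> fo G n"
    using is_functorD(3)[OF G, of n] that by simp
  show "fm G m k (compose (fincard m) g f) a = fm G n k g (fm G m n f a)"
    if "f \<in> Hom Surj m n" "g \<in> Hom Surj n k" "a \<in> fo G m"
    using is_functorD(4)[OF G, of m n k f g] that by (simp add: compose_eq)
qed

lemma bij_chart:
  fixes S :: "'u set"
  assumes "finite S"
  shows "bij_betw (chart S) S (fincard (card S))"
proof -
  have "\<exists>c. bij_betw c S (fincard (card S) :: 'u set)"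
    using assms finite_fincard by (intro finite_same_card_bij) (simp_all add: card_fincard)
  then have "bij_betw (SOME c. bij_betw c S (fincard (card S))) S (fincard (card S) :: 'u set)"
    by (rule someI_ex)
  then show ?thesis
    unfolding chart_def by (simp cong: bij_betw_cong)
qed

lemma finite_image_fincard: "finite (x ` fincard n)"
  by (simp add: finite_fincard)

lemma chart_hom: "compose (fincard n) (chart (x ` fincard n)) x \<in> Hom Surj n (card (x ` fincard n))"
  for x :: "'u \<Rightarrow> 'u"
  using bij_chart[OF finite_image_fincard[of x n]] by (auto simp: compose_def bij_betw_def)

text \<open>Precomposing with a surjection leaves the image of \<open>x\<close> unchanged, and
  functoriality of G absorbs \<open>f\<close> into the map to the chart.\<close>

lemma newton_nf_push:
  assumes G: "is_functor Surj (SET V) G" and f: "f \<in> Hom Surj m n" and a: "a \<in> fo G m"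
  shows "newton_nf G (m, compose (fincard m) x f, a) = newton_nf G (n, x, fm G m n f a)"
proof -
  have "compose (fincard m) x f ` fincard m = x ` f ` fincard m"
    by (auto simp: compose_def image_image)
  then have im: "compose (fincard m) x f ` fincard m = x ` fincard n" using f by simp
  let ?S = "x ` fincard n"
  have "compose (fincard m) (chart ?S) (compose (fincard m) x f)
      = compose (fincard m) (compose (fincard n) (chart ?S) x) f"
    using f by (auto simp: compose_def fun_eq_iff restrict_def)
  then show ?thesis
    unfolding newton_nf_def using im sp_comp[OF G f chart_hom a] by (simp add: Let_def)
qed

text \<open>\<open>m\<close> is the inverse of the chart, that is, the inclusion of the image of
  \<open>x\<close> with its elements renumbered. It depends on the image only, so it recovers every
  \<open>y\<close> with that image.\<close>

lemma newton_factor: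
  fixes x :: "'u \<Rightarrow> 'u"
  assumes x: "x \<in> fincard n \<rightarrow>\<^sub>E X"
  obtains m where "m \<in> fincard (card (x ` fincard n)) \<rightarrow>\<^sub>E X"
    "\<And>l (y :: 'u \<Rightarrow> 'u). y \<in> fincard l \<rightarrow>\<^sub>E X \<Longrightarrow> y ` fincard l = x ` fincard n \<Longrightarrow>
      y = compose (fincard l) m (compose (fincard l) (chart (x ` fincard n)) y)"
proof
  let ?S = "x ` fincard n"
  let ?m = "restrict (inv_into ?S (chart ?S)) (fincard (card ?S))"
  note b = bij_chart[OF finite_image_fincard[of x n]]
  have "inv_into ?S (chart ?S) i \<in> ?S" if "i \<in> fincard (card ?S)" for i
    using b that by (metis bij_betw_def inv_into_into)
  moreover have "?S \<subseteq> X" using x by auto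
  ultimately show "?m \<in> fincard (card ?S) \<rightarrow>\<^sub>E X" by auto
  fix l and y :: "'u \<Rightarrow> 'u"
  assume y: "y \<in> fincard l \<rightarrow>\<^sub>E X" and im: "y ` fincard l = ?S"
  have val: "?m (chart ?S (y i)) = y i" if "i \<in> fincard l" for i
  proof -
    have "y i \<in> ?S" using im that by blast
    moreover have "chart ?S (y i) \<in> fincard (card ?S)" using bij_betwE[OF b] \<open>y i \<in> ?S\<close> by blast
    ultimately show ?thesis using bij_betw_inv_into_left[OF b] by simp
  qed
  have "y \<in> extensional (fincard l)" using y by (simp add: PiE_iff)
  then show "y = compose (fincard l) ?m (compose (fincard l) (chart ?S) y)"
    by (rule extensionalityI) (simp_all only: compose_extensional compose_eq val)
qed

text \<open>Triples with equal normal forms have a common reduct (k, m, G(e) a), where k is the size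
  of the image and \<open>e\<close>, \<open>e'\<close> are the maps to its chart. Independence of
  the triple then needs checking on one generating step only.\<close>

lemma newton_nf_decomp:
  fixes x y :: "'u \<Rightarrow> 'u"
  assumes x: "x \<in> fincard n \<rightarrow>\<^sub>E X" and y: "y \<in> fincard l \<rightarrow>\<^sub>E X"
    and eq: "newton_nf G (n, x, a) = newton_nf G (l, y, b)"
  obtains k m e e' where "m \<in> fincard k \<rightarrow>\<^sub>E X" "e \<in> Hom Surj n k" "e' \<in> Hom Surj l k"
    "x = compose (fincard n) m e" "y = compose (fincard l) m e'" "fm G n k e a = fm G l k e' b"
proof -
  let ?S = "x ` fincard n"
  have S: "y ` fincard l = ?S" using newton_nf_image[OF eq] by simp
  obtain m where m: "m \<in> fincard (card ?S) \<rightarrow>\<^sub>E X"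
    "\<And>l (y :: 'u \<Rightarrow> 'u). y \<in> fincard l \<rightarrow>\<^sub>E X \<Longrightarrow> y ` fincard l = x ` fincard n \<Longrightarrow>
      y = compose (fincard l) m (compose (fincard l) (chart (x ` fincard n)) y)"
    using newton_factor[OF x] by blast
  have "fm G n (card ?S) (compose (fincard n) (chart ?S) x) a
      = fm G l (card ?S) (compose (fincard l) (chart ?S) y) b"
    using eq S by (simp add: newton_nf_def Let_def)
  then show ?thesis
    using that[OF m(1) chart_hom[of n x] _ m(2)[OF x refl] m(2)[OF y S]] chart_hom[of l y]
    unfolding S by blast
qed

text \<open>\<open>f\<close> is an arbitrary function with no target prescribed. This allows
  composing with a left inverse such as \<open>inv_into X f\<close> even where Set has no map
  undoing \<open>f\<close>.\<close>

lemma newton_nf_map: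
  assumes G: "is_functor Surj (SET V) G"
    and x: "x \<in> fincard n \<rightarrow>\<^sub>E X" and y: "y \<in> fincard l \<rightarrow>\<^sub>E X" and ab: "a \<in> fo G n" "b \<in> fo G l"
    and eq: "newton_nf G (n, x, a) = newton_nf G (l, y, b)"
  shows "newton_nf G (n, compose (fincard n) f x, a) = newton_nf G (l, compose (fincard l) f y, b)"
proof -
  obtain k m e e' where d: "m \<in> fincard k \<rightarrow>\<^sub>E X" "e \<in> Hom Surj n k" "e' \<in> Hom Surj l k"
    "x = compose (fincard n) m e" "y = compose (fincard l) m e'" "fm G n k e a = fm G l k e' b"
    by (rule newton_nf_decomp[OF x y eq])
  have "compose (fincard n) f x = compose (fincard n) (compose (fincard k) f m) e"
    "compose (fincard l) f y = compose (fincard l) (compose (fincard k) f m) e'"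
    unfolding d(4,5) using d(2,3) by (auto simp: compose_def fun_eq_iff restrict_def)
  then show ?thesis
    by (simp only: newton_nf_push[OF G d(2) ab(1)] newton_nf_push[OF G d(3) ab(2)] d(6))
qed

lemma sp_nat_mem:
  assumes "nat_trans Surj (SET V) G H t" "a \<in> fo G n"
  shows "t n a \<in> fo H n"
  using nat_transD(4)[OF assms(1), of n] assms by auto

lemma sp_natural:
  assumes "nat_trans Surj (SET V) G H t" "f \<in> Hom Surj m n" "a \<in> fo G m"
  shows "t n (fm G m n f a) = fm H m n f (t m a)"
  using fun_cong[OF nat_transD(5)[OF assms(1), of m n f], of a] assms by (simp add: compose_eq)

lemma newton_nf_trans:
  assumes t: "nat_trans Surj (SET V) G H t"
    and x: "x \<in> fincard n \<rightarrow>\<^sub>E X" and y: "y \<in> fincard l \<rightarrow>\<^sub>E X" and ab: "a \<in> fo G n" "b \<in> fo G l"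
    and eq: "newton_nf G (n, x, a) = newton_nf G (l, y, b)"
  shows "newton_nf H (n, x, t n a) = newton_nf H (l, y, t l b)"
proof -
  have H: "is_functor Surj (SET V) H" by (rule nat_transD(2)[OF t])
  obtain k m e e' where d: "m \<in> fincard k \<rightarrow>\<^sub>E X" "e \<in> Hom Surj n k" "e' \<in> Hom Surj l k"
    "x = compose (fincard n) m e" "y = compose (fincard l) m e'" "fm G n k e a = fm G l k e' b"
    by (rule newton_nf_decomp[OF x y eq])
  show ?thesis
    unfolding d(4,5)
    by (simp only: newton_nf_push[OF H d(2) sp_nat_mem[OF t ab(1)]]
        newton_nf_push[OF H d(3) sp_nat_mem[OF t ab(2)]]
        sp_natural[OF t d(2) ab(1), symmetric] sp_natural[OF t d(3) ab(2), symmetric] d(6))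
qed

text \<open>Here m e = id = m e'. Hence \<open>m\<close> is onto and itself a morphism of Surj, and
  applying G(m) to G(e) a = G(e') b gives a = b.\<close>

lemma newton_nf_id_inj:
  assumes G: "is_functor Surj (SET V) G" and ab: "a \<in> fo G n" "b \<in> fo G n"
    and eq: "newton_nf G (n, \<lambda>i\<in>fincard n. i, a) = newton_nf G (n, \<lambda>i\<in>fincard n. i, b)"
  shows "a = b"
proof -
  let ?id = "(\<lambda>i\<in>fincard n. i) :: 'u \<Rightarrow> 'u"
  have id: "?id \<in> fincard n \<rightarrow>\<^sub>E fincard n" by auto
  obtain k m e e' where d: "m \<in> fincard k \<rightarrow>\<^sub>E fincard n" "e \<in> Hom Surj n k" "e' \<in> Hom Surj n k"
    "?id = compose (fincard n) m e" "?id = compose (fincard n) m e'" "fm G n k e a = fm G n k e' b"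
    by (rule newton_nf_decomp[OF id id eq])
  have "i \<in> m ` fincard k" if "i \<in> fincard n" for i
  proof -
    have "m (e i) = i" using fun_cong[OF d(4), of i] that by (simp add: compose_eq)
    moreover have "e i \<in> fincard k" using Surj_hom_PiE[OF d(2)] that by auto
    ultimately show ?thesis by (metis imageI)
  qed
  then have m: "m \<in> Hom Surj k n" using d(1) by auto
  have "a = fm G k n m (fm G n k e a)"
    using sp_comp[OF G d(2) m ab(1)] sp_id[OF G ab(1)] d(4) by simp
  also have "\<dots> = b"
    using sp_comp[OF G d(3) m ab(2)] sp_id[OF G ab(2)] d(5,6) by simp
  finally show ?thesis .
qed

section \<open>The coend relation and its classes\<close>

lemma newton_pre_iff: "(n, x, a) \<in> newton_pre G X \<longleftrightarrow> x \<in> fincard n \<rightarrow>\<^sub>E X \<and> a \<in> fo G n"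
  by (simp add: newton_pre_def)

text \<open>Every generating step preserves the normal form. Conversely two triples with the same
  normal form are joined by a zigzag of length two through their common reduct.\<close>

lemma newton_rel_eq:
  assumes G: "is_functor Surj (SET V) G"
  shows "newton_rel G X =
    {(s, t). s \<in> newton_pre G X \<and> t \<in> newton_pre G X \<and> newton_nf G s = newton_nf G t}"
proof -
  have step: "newton_nf G s = newton_nf G t" if "(s, t) \<in> newton_step G X" for s t
    using that newton_nf_push[OF G] unfolding newton_step_def by blast
  have "newton_nf G s = newton_nf G t" if "(s, t) \<in> (newton_step G X \<union> (newton_step G X)\<inverse>)\<^sup>*" for s t
    using that by (induction rule: rtrancl_induct) (auto dest: step)
  moreover have "(s, t) \<in> (newton_step G X \<union> (newton_step G X)\<inverse>)\<^sup>*"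
    if pre: "s \<in> newton_pre G X" "t \<in> newton_pre G X" and eq: "newton_nf G s = newton_nf G t" for s t
  proof -
    obtain n x a l y b where st: "s = (n, x, a)" "t = (l, y, b)" by (metis prod_cases3)
    have x: "x \<in> fincard n \<rightarrow>\<^sub>E X" "a \<in> fo G n" and y: "y \<in> fincard l \<rightarrow>\<^sub>E X" "b \<in> fo G l"
      using pre unfolding st newton_pre_iff by auto
    obtain k m e e' where d: "m \<in> fincard k \<rightarrow>\<^sub>E X" "e \<in> Hom Surj n k" "e' \<in> Hom Surj l k"
      "x = compose (fincard n) m e" "y = compose (fincard l) m e'" "fm G n k e a = fm G l k e' b"
      by (rule newton_nf_decomp[OF x(1) y(1) eq[unfolded st]])
    have "(s, (k, m, fm G n k e a)) \<in> newton_step G X"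
      unfolding st d(4) newton_step_def using d(1,2) x(2) by blast
    moreover have "(t, (k, m, fm G n k e a)) \<in> newton_step G X"
      unfolding st d(5,6) newton_step_def using d(1,3) y(2) by blast
    ultimately show ?thesis
      by (meson UnI1 UnI2 converseI r_into_rtrancl rtrancl_trans)
  qed
  ultimately show ?thesis unfolding newton_rel_def by blast
qed

text \<open>A class is coded through one chosen representative. The code is injective on triples, so
  equal codes come from the same representative, which has the normal form of both \<open>s\<close>
  and \<open>t\<close>.\<close>

lemma newton_in_eq_iff:
  assumes G: "is_functor Surj (SET V) G" and s: "s \<in> newton_pre G X" and t: "t \<in> newton_pre G X"
  shows "newton_in G X s = newton_in G X t \<longleftrightarrow> newton_nf G s = newton_nf G t"
proof
  assume "newton_nf G s = newton_nf G t"
  then have "newton_rel G X `` {s} = newton_rel G X `` {t}"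
    unfolding newton_rel_eq[OF G] using s t by auto
  then show "newton_in G X s = newton_in G X t" by (simp add: newton_in_def)
next
  assume eq: "newton_in G X s = newton_in G X t"
  have rep: "(SOME r. r \<in> newton_rel G X `` {u}) \<in> newton_rel G X `` {u}" if "u \<in> newton_pre G X" for u
    by (rule someI[of _ u]) (simp add: newton_rel_eq[OF G] that)
  have sub: "newton_pre G X \<subseteq> {(n, x, a). x \<in> extensional (fincard n)}"
    by (auto simp: newton_pre_def PiE_iff)
  define p q where "p = (SOME r. r \<in> newton_rel G X `` {s})" "q = (SOME r. r \<in> newton_rel G X `` {t})"
  have p: "p \<in> newton_pre G X" "newton_nf G s = newton_nf G p"
    and q: "q \<in> newton_pre G X" "newton_nf G t = newton_nf G q"
    using rep[OF s] rep[OF t] unfolding p_q_def newton_rel_eq[OF G] by auto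
  have "triple_code p = triple_code q" using eq by (simp add: newton_in_def class_code_def p_q_def)
  then have "p = q" using p q sub by (intro inj_onD[OF inj_on_triple_code]) auto
  then show "newton_nf G s = newton_nf G t" using p q by simp
qed

lemma newton_obj_eq: "newton_obj G X = newton_in G X ` newton_pre G X"
  by (auto simp: newton_obj_def newton_in_def quotient_def)

lemma newton_in_mem:
  "x \<in> fincard n \<rightarrow>\<^sub>E X \<Longrightarrow> a \<in> fo G n \<Longrightarrow> newton_in G X (n, x, a) \<in> newton_obj G X"
  unfolding newton_obj_eq by (intro imageI) (simp add: newton_pre_iff)

lemma newton_objE:
  assumes "z \<in> newton_obj G X"
  obtains n x a where "x \<in> fincard n \<rightarrow>\<^sub>E X" "a \<in> fo G n" "z = newton_in G X (n, x, a)"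
  using assms unfolding newton_obj_eq by (auto simp: newton_pre_def)

lemma newton_in_push:
  assumes G: "is_functor Surj (SET V) G" and f: "f \<in> Hom Surj m n" and a: "a \<in> fo G m"
    and x: "x \<in> fincard n \<rightarrow>\<^sub>E X"
  shows "newton_in G X (m, compose (fincard m) x f, a) = newton_in G X (n, x, fm G m n f a)"
  using newton_in_eq_iff[OF G] newton_nf_push[OF G f a] x a sp_mem[OF G f a]
    compose_PiE[OF Surj_hom_PiE[OF f] x] by (simp add: newton_pre_iff)

section \<open>Maps out of the coend\<close>

text \<open>Maps out of a Newton sum are all given by a \<open>THE\<close> of this shape. Here
  \<open>h\<close> is the formula on triples, and its independence of the triple evaluates the
  description.\<close>

lemma newton_descend:
  assumes pre: "(n, x, a) \<in> newton_pre G X"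
    and wd: "\<And>l y b. (l, y, b) \<in> newton_pre G X \<Longrightarrow> newton_in G X (n, x, a) = newton_in G X (l, y, b) \<Longrightarrow>
      h n x a = h l y b"
  shows "(THE w. \<exists>l y b. (l, y, b) \<in> newton_pre G X \<and> newton_in G X (n, x, a) = newton_in G X (l, y, b)
      \<and> w = h l y b) = h n x a"
proof (rule the_equality)
  show "\<exists>l y b. (l, y, b) \<in> newton_pre G X \<and> newton_in G X (n, x, a) = newton_in G X (l, y, b)
      \<and> h n x a = h l y b" using pre by blast
  show "w = h n x a" if "\<exists>l y b. (l, y, b) \<in> newton_pre G X \<and>
      newton_in G X (n, x, a) = newton_in G X (l, y, b) \<and> w = h l y b" for w
    using that wd by metis
qed

lemma newton_arr_in:
  assumes G: "is_functor Surj (SET V) G" and f: "f \<in> X \<rightarrow>\<^sub>E Y"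
    and x: "x \<in> fincard n \<rightarrow>\<^sub>E X" and a: "a \<in> fo G n"
  shows "newton_arr G X Y f (newton_in G X (n, x, a)) = newton_in G Y (n, compose (fincard n) f x, a)"
proof -
  have pre: "(n, x, a) \<in> newton_pre G X" using x a by (simp add: newton_pre_iff)
  have "newton_in G Y (n, compose (fincard n) f x, a) = newton_in G Y (l, compose (fincard l) f y, b)"
    if y: "(l, y, b) \<in> newton_pre G X" and eq: "newton_in G X (n, x, a) = newton_in G X (l, y, b)" for l y b
  proof -
    have y': "y \<in> fincard l \<rightarrow>\<^sub>E X" "b \<in> fo G l" using y by (simp_all add: newton_pre_iff)
    have "newton_nf G (n, x, a) = newton_nf G (l, y, b)" using newton_in_eq_iff[OF G pre y] eq by simp
    then show ?thesis
      using newton_nf_map[OF G x y'(1) a y'(2), of f] newton_in_eq_iff[OF G, of _ Y]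
        compose_PiE[OF x f] compose_PiE[OF y'(1) f] a y'(2) by (simp add: newton_pre_iff)
  qed
  then show ?thesis
    unfolding newton_arr_def
    using newton_descend[OF pre, of "\<lambda>n x a. newton_in G Y (n, compose (fincard n) f x, a)"]
      newton_in_mem[OF x a] by simp
qed

lemma newton_trans_in:
  assumes t: "nat_trans Surj (SET V) G H t" and X: "X \<in> V"
    and x: "x \<in> fincard n \<rightarrow>\<^sub>E X" and a: "a \<in> fo G n"
  shows "newton_trans V G H t X (newton_in G X (n, x, a)) = newton_in H X (n, x, t n a)"
proof -
  have G: "is_functor Surj (SET V) G" and H: "is_functor Surj (SET V) H"
    using nat_transD[OF t] by auto
  have pre: "(n, x, a) \<in> newton_pre G X" using x a by (simp add: newton_pre_iff)
  have "newton_in H X (n, x, t n a) = newton_in H X (l, y, t l b)"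
    if y: "(l, y, b) \<in> newton_pre G X" and eq: "newton_in G X (n, x, a) = newton_in G X (l, y, b)" for l y b
  proof -
    have y': "y \<in> fincard l \<rightarrow>\<^sub>E X" "b \<in> fo G l" using y by (simp_all add: newton_pre_iff)
    have "newton_nf G (n, x, a) = newton_nf G (l, y, b)" using newton_in_eq_iff[OF G pre y] eq by simp
    then show ?thesis
      using newton_nf_trans[OF t x y'(1) a y'(2)] newton_in_eq_iff[OF H, of _ X]
        x y'(1) sp_nat_mem[OF t a] sp_nat_mem[OF t y'(2)] by (simp add: newton_pre_iff)
  qed
  then show ?thesis
    unfolding newton_trans_def
    using newton_descend[OF pre, of "\<lambda>n x a. newton_in H X (n, x, t n a)"]
      newton_in_mem[OF x a] X by simp
qed

section \<open>Newton sums as taut functors\<close>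

text \<open>The triples have a type of their own, so V is reached one coordinate at a time: a
  countable union over n, a union over G(n), and an encoded image of the functions into X.\<close>

lemma V_newton_obj:
  assumes G: "is_functor Surj (SET V) G" and X: "X \<in> V"
  shows "newton_obj G X \<in> V"
proof -
  have "newton_obj G X = (\<Union>n. \<Union>a\<in>fo G n. (\<lambda>x. newton_in G X (n, x, a)) ` (fincard n \<rightarrow>\<^sub>E X))"
    by (auto simp: newton_obj_eq newton_pre_def)
  also have "\<dots> \<in> V"
    by (intro V_countable_UN V_UN sp_V[OF G] V_image_PiE finite_fincard X)
  finally show ?thesis .
qed

lemma newton_arr_PiE:
  assumes G: "is_functor Surj (SET V) G" and f: "f \<in> X \<rightarrow>\<^sub>E Y"
  shows "newton_arr G X Y f \<in> newton_obj G X \<rightarrow>\<^sub>E newton_obj G Y"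
proof (rule PiE_I)
  fix z assume "z \<in> newton_obj G X"
  then show "newton_arr G X Y f z \<in> newton_obj G Y"
    by (elim newton_objE) (simp add: newton_arr_in[OF G f] newton_in_mem[OF compose_PiE[OF _ f]])
qed (simp add: newton_arr_def)

lemma compose_id_right: "x \<in> A \<rightarrow>\<^sub>E X \<Longrightarrow> compose A (\<lambda>i\<in>X. i) x = x"
  by (auto simp: compose_def fun_eq_iff restrict_def PiE_iff extensional_def)

lemma compose_id_left: "x \<in> A \<rightarrow>\<^sub>E X \<Longrightarrow> compose A x (\<lambda>i\<in>A. i) = x"
  by (auto simp: compose_def fun_eq_iff restrict_def PiE_iff extensional_def)

lemma functor_newton_sum:
  assumes G: "is_functor Surj (SET V) G"
  shows "is_functor (SET V) (SET V) (newton_sum V G)"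
  unfolding newton_sum_def
proof (rule is_functor_ftor_onI[OF category_SET category_SET])
  show "newton_obj G X \<in> Obj (SET V)" if "X \<in> Obj (SET V)" for X using that V_newton_obj[OF G] by simp
  show "newton_arr G X Y f \<in> Hom (SET V) (newton_obj G X) (newton_obj G Y)"
    if "f \<in> Hom (SET V) X Y" for X Y f using that newton_arr_PiE[OF G] by simp
  show "newton_arr G X X (Ide (SET V) X) = Ide (SET V) (newton_obj G X)" for X
  proof -
    have id: "(\<lambda>x\<in>X. x) \<in> X \<rightarrow>\<^sub>E X" by auto
    have "newton_arr G X X (\<lambda>x\<in>X. x) z = z" if "z \<in> newton_obj G X" for z
      using that by (elim newton_objE) (simp add: newton_arr_in[OF G id] compose_id_right)
    then show ?thesis unfolding SET_sel by (intro PiE_ext[OF newton_arr_PiE[OF G id]]) auto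
  qed
  show "newton_arr G X Z (Comp (SET V) X Y Z g f) =
    Comp (SET V) (newton_obj G X) (newton_obj G Y) (newton_obj G Z) (newton_arr G Y Z g) (newton_arr G X Y f)"
    if "f \<in> Hom (SET V) X Y" "g \<in> Hom (SET V) Y Z" for X Y Z f g
  proof -
    have f: "f \<in> X \<rightarrow>\<^sub>E Y" and g: "g \<in> Y \<rightarrow>\<^sub>E Z" using that by auto
    have "newton_arr G X Z (compose X g f) z = newton_arr G Y Z g (newton_arr G X Y f z)"
      if z: "z \<in> newton_obj G X" for z
    proof -
      obtain n x a where x: "x \<in> fincard n \<rightarrow>\<^sub>E X" "a \<in> fo G n" "z = newton_in G X (n, x, a)"
        using newton_objE[OF z] .
      have "compose (fincard n) (compose X g f) x = compose (fincard n) g (compose (fincard n) f x)"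
        using x(1) by (auto simp: compose_def fun_eq_iff restrict_def)
      then show ?thesis unfolding x(3)
        by (simp add: newton_arr_in[OF G compose_PiE[OF f g] x(1,2)] newton_arr_in[OF G f x(1,2)]
            newton_arr_in[OF G g compose_PiE[OF x(1) f] x(2)])
    qed
    then show ?thesis unfolding SET_sel
      by (intro PiE_ext[OF newton_arr_PiE[OF G compose_PiE[OF f g]]
            compose_PiE[OF newton_arr_PiE[OF G f] newton_arr_PiE[OF G g]]]) (simp add: compose_eq)
  qed
qed

lemma fo_newton_sum: "X \<in> V \<Longrightarrow> fo (newton_sum V G) X = newton_obj G X"
  by (simp add: newton_sum_def)

lemma fm_newton_sum: "X \<in> V \<Longrightarrow> Y \<in> V \<Longrightarrow> f \<in> X \<rightarrow>\<^sub>E Y \<Longrightarrow> fm (newton_sum V G) X Y f = newton_arr G X Y f"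
  by (simp add: newton_sum_def)

text \<open>Composing with the inclusion of S does not change a triple, and the image of
  \<open>x\<close> is the same for all triples of a class. So one representative with values in S
  forces this of \<open>x\<close>.\<close>

lemma newton_img_iff:
  assumes G: "is_functor Surj (SET V) G" and X: "X \<in> V" "S \<subseteq> X"
    and x: "x \<in> fincard n \<rightarrow>\<^sub>E X" and a: "a \<in> fo G n"
  shows "newton_in G X (n, x, a) \<in> img (newton_sum V G) X S \<longleftrightarrow> x ` fincard n \<subseteq> S"
proof
  have S: "S \<in> V" using X V_subset by blast
  have i: "(\<lambda>s\<in>S. s) \<in> S \<rightarrow>\<^sub>E X" using X(2) by (rule id_PiE)
  { assume "newton_in G X (n, x, a) \<in> img (newton_sum V G) X S"
    then obtain z where z: "z \<in> newton_obj G S" "newton_in G X (n, x, a) = newton_arr G S X (\<lambda>s\<in>S. s) z"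
      unfolding img_def fo_newton_sum[OF S] fm_newton_sum[OF S X(1) i] by blast
    obtain l y b where y: "y \<in> fincard l \<rightarrow>\<^sub>E S" "b \<in> fo G l" "z = newton_in G S (l, y, b)"
      using newton_objE[OF z(1)] .
    have "newton_in G X (n, x, a) = newton_in G X (l, compose (fincard l) (\<lambda>s\<in>S. s) y, b)"
      using z(2) unfolding y(3) newton_arr_in[OF G i y(1,2)] .
    then have "newton_nf G (n, x, a) = newton_nf G (l, compose (fincard l) (\<lambda>s\<in>S. s) y, b)"
      using newton_in_eq_iff[OF G, of _ X] x a y(2) compose_PiE[OF y(1) i] by (simp add: newton_pre_iff)
    then have "x ` fincard n = y ` fincard l"
      using newton_nf_image compose_id_right[OF y(1)] by metis
    then show "x ` fincard n \<subseteq> S" using y(1) by auto }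
  assume "x ` fincard n \<subseteq> S"
  then have xS: "x \<in> fincard n \<rightarrow>\<^sub>E S" using x by (auto simp: PiE_iff)
  show "newton_in G X (n, x, a) \<in> img (newton_sum V G) X S"
    unfolding img_def fo_newton_sum[OF S] fm_newton_sum[OF S X(1) i]
    using newton_arr_in[OF G i xS a] compose_id_right[OF xS] newton_in_mem[OF xS a] by force
qed

lemma taut_newton_sum:
  assumes G: "is_functor Surj (SET V) G"
  shows "taut_functor (SET V) (SET V) (newton_sum V G)"
proof (rule taut_functorI[OF functor_newton_sum[OF G]])
  fix X Y f assume V: "X \<in> V" "Y \<in> V" and f: "f \<in> X \<rightarrow>\<^sub>E Y" "inj_on f X"
  show "inj_on (fm (newton_sum V G) X Y f) (fo (newton_sum V G) X)"
    unfolding fo_newton_sum[OF V(1)] fm_newton_sum[OF V f(1)]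
  proof (rule inj_onI)
    fix z w assume "z \<in> newton_obj G X" "w \<in> newton_obj G X" and eq: "newton_arr G X Y f z = newton_arr G X Y f w"
    then obtain n x a l y b where x: "x \<in> fincard n \<rightarrow>\<^sub>E X" "a \<in> fo G n" "z = newton_in G X (n, x, a)"
      and y: "y \<in> fincard l \<rightarrow>\<^sub>E X" "b \<in> fo G l" "w = newton_in G X (l, y, b)"
      by (elim newton_objE)
    note fx = compose_PiE[OF x(1) f(1)] and fy = compose_PiE[OF y(1) f(1)]
    have "newton_nf G (n, compose (fincard n) f x, a) = newton_nf G (l, compose (fincard l) f y, b)"
      using eq newton_in_eq_iff[OF G, of _ Y] fx fy x y
      by (simp add: newton_pre_iff newton_arr_in[OF G f(1)])
    \<comment> \<open>\<open>inv_into X f\<close> serves as a bare function, evaluated on the image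
      of \<open>f\<close>; a map from Y to X undoing \<open>f\<close> need not exist when X is
      empty.\<close>
    then have "newton_nf G (n, compose (fincard n) (inv_into X f) (compose (fincard n) f x), a)
        = newton_nf G (l, compose (fincard l) (inv_into X f) (compose (fincard l) f y), b)"
      by (rule newton_nf_map[OF G fx fy x(2) y(2)])
    moreover have "compose (fincard k) (inv_into X f) (compose (fincard k) f u) = u"
      if "u \<in> fincard k \<rightarrow>\<^sub>E X" for k and u :: "'u \<Rightarrow> 'u"
      using that f(2) by (auto simp: compose_def fun_eq_iff restrict_def PiE_iff extensional_def)
    ultimately show "z = w"
      using newton_in_eq_iff[OF G, of _ X] x y by (simp add: newton_pre_iff)
  qed
next
  fix X Y f S z assume V: "X \<in> V" "Y \<in> V" and f: "f \<in> X \<rightarrow>\<^sub>E Y" and S: "S \<subseteq> Y"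
    and z: "z \<in> fo (newton_sum V G) X" "fm (newton_sum V G) X Y f z \<in> img (newton_sum V G) Y S"
  obtain n x a where x: "x \<in> fincard n \<rightarrow>\<^sub>E X" "a \<in> fo G n" "z = newton_in G X (n, x, a)"
    using z(1) unfolding fo_newton_sum[OF V(1)] by (rule newton_objE)
  have "compose (fincard n) f x ` fincard n \<subseteq> S"
    using z(2) unfolding x(3) fm_newton_sum[OF V f] newton_arr_in[OF G f x(1,2)]
      newton_img_iff[OF G V(2) S compose_PiE[OF x(1) f] x(2)] .
  then have "x ` fincard n \<subseteq> {x \<in> X. f x \<in> S}" using x(1) by (auto simp: compose_def)
  then show "z \<in> img (newton_sum V G) X {x \<in> X. f x \<in> S}"
    unfolding x(3) using newton_img_iff[OF G V(1) _ x(1,2)] by simp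
qed

section \<open>Newton summation on natural transformations\<close>

lemma newton_trans_PiE:
  assumes t: "nat_trans Surj (SET V) G H t" and X: "X \<in> V"
  shows "newton_trans V G H t X \<in> newton_obj G X \<rightarrow>\<^sub>E newton_obj H X"
proof (rule PiE_I)
  fix z assume "z \<in> newton_obj G X"
  then show "newton_trans V G H t X z \<in> newton_obj H X"
    by (elim newton_objE) (simp add: newton_trans_in[OF t X] newton_in_mem sp_nat_mem[OF t])
qed (simp add: newton_trans_def X)

lemma taut_newton_trans:
  assumes t: "nat_trans Surj (SET V) G H t"
  shows "taut_trans (SET V) (SET V) (newton_sum V G) (newton_sum V H) (newton_trans V G H t)"
proof (rule taut_transI)
  have G: "is_functor Surj (SET V) G" and H: "is_functor Surj (SET V) H"
    using nat_transD[OF t] by auto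
  show "taut_functor (SET V) (SET V) (newton_sum V G)" "taut_functor (SET V) (SET V) (newton_sum V H)"
    using taut_newton_sum G H by auto
  have "compose (newton_obj G X) (newton_trans V G H t Y) (newton_arr G X Y f)
      = compose (newton_obj G X) (newton_arr H X Y f) (newton_trans V G H t X)"
    if V: "X \<in> V" "Y \<in> V" and f: "f \<in> X \<rightarrow>\<^sub>E Y" for X Y f
  proof (rule PiE_ext[OF compose_PiE[OF newton_arr_PiE[OF G f] newton_trans_PiE[OF t V(2)]]
          compose_PiE[OF newton_trans_PiE[OF t V(1)] newton_arr_PiE[OF H f]]])
    fix z assume z: "z \<in> newton_obj G X"
    obtain n x a where x: "x \<in> fincard n \<rightarrow>\<^sub>E X" "a \<in> fo G n" "z = newton_in G X (n, x, a)"
      using newton_objE[OF z] .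
    show "compose (newton_obj G X) (newton_trans V G H t Y) (newton_arr G X Y f) z
        = compose (newton_obj G X) (newton_arr H X Y f) (newton_trans V G H t X) z"
      unfolding compose_eq[OF z] unfolding x(3) newton_arr_in[OF G f x(1,2)]
        newton_trans_in[OF t V(1) x(1,2)] newton_trans_in[OF t V(2) compose_PiE[OF x(1) f] x(2)]
        newton_arr_in[OF H f x(1) sp_nat_mem[OF t x(2)]] ..
  qed
  then show "nat_trans (SET V) (SET V) (newton_sum V G) (newton_sum V H) (newton_trans V G H t)"
    unfolding nat_trans_def using functor_newton_sum[OF G] functor_newton_sum[OF H] newton_trans_PiE[OF t]
    by (simp add: fo_newton_sum fm_newton_sum newton_trans_def)
  fix X S z assume X: "X \<in> V" "S \<subseteq> X" and z: "z \<in> fo (newton_sum V G) X"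
    "newton_trans V G H t X z \<in> img (newton_sum V H) X S"
  obtain n x a where x: "x \<in> fincard n \<rightarrow>\<^sub>E X" "a \<in> fo G n" "z = newton_in G X (n, x, a)"
    using z(1) unfolding fo_newton_sum[OF X(1)] by (rule newton_objE)
  \<comment> \<open>\<open>t\<close> acts on the label \<open>a\<close> alone, while membership in
    the image depends on \<open>x\<close> alone.\<close>
  show "z \<in> img (newton_sum V G) X S"
    using z(2) unfolding x(3) newton_trans_in[OF t X(1) x(1,2)] newton_img_iff[OF G X x(1,2)]
      newton_img_iff[OF H X x(1) sp_nat_mem[OF t x(2)]] .
qed

lemma functor_Newton: "is_functor (SoftSp V) (Taut V) (Newton V)"
  unfolding Newton_def
proof (rule is_functor_ftor_onI[OF category_SoftSp category_Taut])
  fix G assume "G \<in> Obj (SoftSp V)"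
  then have G: "is_functor Surj (SET V) G" by simp
  show "newton_sum V G \<in> Obj (Taut V)" using taut_newton_sum[OF G] by simp
  have t: "nat_trans Surj (SET V) G G (trans_id Surj (SET V) G)" by (rule nat_trans_id[OF G])
  show "newton_trans V G G (Ide (SoftSp V) G) = Ide (Taut V) (newton_sum V G)"
  proof
    fix X
    show "newton_trans V G G (Ide (SoftSp V) G) X = Ide (Taut V) (newton_sum V G) X"
    proof (cases "X \<in> V")
      case True
      have "newton_trans V G G (trans_id Surj (SET V) G) X z = z" if "z \<in> newton_obj G X" for z
        using that by (elim newton_objE) (simp add: newton_trans_in[OF t True], simp add: trans_id_def)
      then have "newton_trans V G G (trans_id Surj (SET V) G) X = (\<lambda>z\<in>newton_obj G X. z)"
        by (intro PiE_ext[OF newton_trans_PiE[OF t True]]) auto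
      then show ?thesis using True by (simp add: trans_id_def[of "SET V"] fo_newton_sum)
    qed (simp add: newton_trans_def trans_id_def)
  qed
next
  fix G H t assume "t \<in> Hom (SoftSp V) G H"
  then show "newton_trans V G H t \<in> Hom (Taut V) (newton_sum V G) (newton_sum V H)"
    by (simp add: taut_newton_trans)
next
  fix G H K t s assume "t \<in> Hom (SoftSp V) G H" "s \<in> Hom (SoftSp V) H K"
  then have t: "nat_trans Surj (SET V) G H t" and s: "nat_trans Surj (SET V) H K s" by simp_all
  let ?st = "trans_comp Surj (SET V) G H K s t"
  note st = nat_trans_comp[OF t s]
  show "newton_trans V G K (Comp (SoftSp V) G H K s t) = Comp (Taut V) (newton_sum V G) (newton_sum V H)
      (newton_sum V K) (newton_trans V H K s) (newton_trans V G H t)"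
  proof
    fix X
    show "newton_trans V G K (Comp (SoftSp V) G H K s t) X = Comp (Taut V) (newton_sum V G)
        (newton_sum V H) (newton_sum V K) (newton_trans V H K s) (newton_trans V G H t) X"
    proof (cases "X \<in> V")
      case True
      have "newton_trans V G K ?st X z = newton_trans V H K s X (newton_trans V G H t X z)"
        if z: "z \<in> newton_obj G X" for z
      proof -
        obtain n x a where x: "x \<in> fincard n \<rightarrow>\<^sub>E X" "a \<in> fo G n" "z = newton_in G X (n, x, a)"
          using newton_objE[OF z] .
        show ?thesis
          unfolding x(3) newton_trans_in[OF t True x(1,2)] newton_trans_in[OF st True x(1,2)]
            newton_trans_in[OF s True x(1) sp_nat_mem[OF t x(2)]]
          using x(2) by (simp add: trans_comp_def compose_eq)
      qed
      then have "newton_trans V G K ?st X =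
          compose (newton_obj G X) (newton_trans V H K s X) (newton_trans V G H t X)"
        by (intro PiE_ext[OF newton_trans_PiE[OF st True]
              compose_PiE[OF newton_trans_PiE[OF t True] newton_trans_PiE[OF s True]]])
           (simp add: compose_eq)
      then show ?thesis using True by (simp add: trans_comp_def[of "SET V"] fo_newton_sum)
    qed (simp add: newton_trans_def trans_comp_def)
  qed
qed

end

subsection \<open>The adjunction\<close>

definition newton_unit :: "'u soft_species \<Rightarrow> nat \<Rightarrow> 'u \<Rightarrow> 'u" where
  "newton_unit G = (\<lambda>n. \<lambda>b\<in>fo G n. newton_in G (fincard n) (n, \<lambda>i\<in>fincard n. i, b))"

definition transpose ::
  "'u soft_species \<Rightarrow> ('u set \<Rightarrow> 'u \<Rightarrow> 'u) \<Rightarrow> nat \<Rightarrow> 'u \<Rightarrow> 'u" where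
  "transpose G t = (\<lambda>n. \<lambda>b\<in>fo G n. t (fincard n) (newton_unit G n b))"

definition untranspose ::
  "'u set set \<Rightarrow> 'u soft_species \<Rightarrow> 'u set_functor \<Rightarrow> (nat \<Rightarrow> 'u \<Rightarrow> 'u) \<Rightarrow> 'u set \<Rightarrow> 'u \<Rightarrow> 'u" where
  "untranspose V G F s = (\<lambda>X\<in>V. \<lambda>z\<in>newton_obj G X. THE w.
     \<exists>n x a. (n, x, a) \<in> newton_pre G X \<and> z = newton_in G X (n, x, a) \<and>
       w = fm F (fincard n) X x (s n a))"

context universe
begin

lemma fo_Newton: "is_functor Surj (SET V) G \<Longrightarrow> fo (Newton V) G = newton_sum V G"
  by (simp add: Newton_def)

lemma fm_Newton: "nat_trans Surj (SET V) G H t \<Longrightarrow> fm (Newton V) G H t = newton_trans V G H t"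
  by (simp add: Newton_def nat_transD(1,2))

lemma fo_DeltaStar: "taut_functor (SET V) (SET V) F \<Longrightarrow> fo (DeltaStar V) F = diff_star V F"
  by (simp add: DeltaStar_def)

lemma fm_DeltaStar:
  "taut_functor (SET V) (SET V) F \<Longrightarrow> taut_functor (SET V) (SET V) F' \<Longrightarrow>
    taut_trans (SET V) (SET V) F F' t \<Longrightarrow> fm (DeltaStar V) F F' t = diff_star_trans V F F' t"
  by (simp add: DeltaStar_def)

section \<open>The unit and its image\<close>

lemma id_fincard: "(\<lambda>i\<in>fincard n. i) \<in> fincard n \<rightarrow>\<^sub>E fincard n"
  by auto

lemma newton_unit_apply:
  "b \<in> fo G n \<Longrightarrow> newton_unit G n b = newton_in G (fincard n) (n, \<lambda>i\<in>fincard n. i, b)"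
  by (simp add: newton_unit_def)

lemma newton_unit_mem: "b \<in> fo G n \<Longrightarrow> newton_unit G n b \<in> newton_obj G (fincard n)"
  by (simp only: newton_unit_apply newton_in_mem[OF id_fincard])

text \<open>A fact in the style of Yoneda: every element of a Newton sum is obtained from a unit
  element by functoriality, so transformations out of it are determined on the units.\<close>

lemma newton_arr_unit:
  assumes G: "is_functor Surj (SET V) G" and x: "x \<in> fincard n \<rightarrow>\<^sub>E X" and b: "b \<in> fo G n"
  shows "newton_arr G (fincard n) X x (newton_unit G n b) = newton_in G X (n, x, b)"
  by (simp only: newton_unit_apply[OF b] newton_arr_in[OF G x id_fincard b] compose_id_left[OF x])

text \<open>The triples (m, f, b) and (n, id, G(f) b) are related by the generating step for
  \<open>f\<close> itself.\<close>

lemma newton_unit_natural: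
  assumes G: "is_functor Surj (SET V) G" and f: "f \<in> Hom Surj m n" and b: "b \<in> fo G m"
  shows "newton_unit G n (fm G m n f b) = newton_arr G (fincard m) (fincard n) f (newton_unit G m b)"
  using newton_in_push[OF G f b id_fincard] compose_id_right[OF Surj_hom_PiE[OF f]]
  by (simp only: newton_arr_unit[OF G Surj_hom_PiE[OF f] b] newton_unit_apply[OF sp_mem[OF G f b]])

lemma newton_trans_unit:
  assumes t: "nat_trans Surj (SET V) G H t" and b: "b \<in> fo G n"
  shows "newton_trans V G H t (fincard n) (newton_unit G n b) = newton_unit H n (t n b)"
  by (simp only: newton_unit_apply[OF b] newton_unit_apply[OF sp_nat_mem[OF t b]]
      newton_trans_in[OF t V_fincard id_fincard b])

lemma iter_diff_zero_newton_sum: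
  assumes G: "is_functor Surj (SET V) G"
  shows "iter_diff_zero V (newton_sum V G) n = newton_unit G n ` fo G n"
proof (intro equalityI subsetI)
  note iff = iter_diff_zero_iff[OF functor_newton_sum[OF G]]
  fix z assume z: "z \<in> iter_diff_zero V (newton_sum V G) n"
  then have "z \<in> newton_obj G (fincard n)" unfolding iff fo_newton_sum[OF V_fincard] by blast
  then obtain k x b where x: "x \<in> fincard k \<rightarrow>\<^sub>E fincard n" "b \<in> fo G k" "z = newton_in G (fincard n) (k, x, b)"
    by (rule newton_objE)
  have sub: "x ` fincard k \<subseteq> fincard n" using x(1) by auto
  then have "x ` fincard k = fincard n"
    using z newton_img_iff[OF G V_fincard sub x(1,2)] unfolding x(3) iff by blast
  \<comment> \<open>Being onto, \<open>x\<close> is a morphism of Surj, so the label can be pushed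
    along it and the triple becomes (n, id, G(x) b).\<close>
  then have hom: "x \<in> Hom Surj k n" using x(1) by simp
  have "z = newton_unit G n (fm G k n x b)"
    using newton_in_push[OF G hom x(2) id_fincard] compose_id_right[OF x(1)] x(3)
    by (simp only: newton_unit_apply[OF sp_mem[OF G hom x(2)]])
  then show "z \<in> newton_unit G n ` fo G n" using sp_mem[OF G hom x(2)] by blast
next
  note iff = iter_diff_zero_iff[OF functor_newton_sum[OF G]]
  fix z assume "z \<in> newton_unit G n ` fo G n"
  then obtain b where b: "b \<in> fo G n" "z = newton_unit G n b" by blast
  have "(\<lambda>i\<in>fincard n. i) ` fincard n = fincard n" by auto
  then show "z \<in> iter_diff_zero V (newton_sum V G) n"
    unfolding iff fo_newton_sum[OF V_fincard]
    using newton_unit_mem[OF b(1)] b newton_unit_apply[OF b(1)]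
      newton_img_iff[OF G V_fincard _ id_fincard b(1)] by auto
qed

lemma natural_iso_newton_unit:
  assumes G: "is_functor Surj (SET V) G"
  shows "natural_iso Surj (SET V) G (diff_star V (newton_sum V G)) (newton_unit G)"
proof -
  let ?D = "diff_star V (newton_sum V G)"
  note D = functor_diff_star[OF taut_newton_sum[OF G]]
  have foD: "fo ?D n = newton_unit G n ` fo G n" for n
    by (simp add: fo_diff_star iter_diff_zero_newton_sum[OF G])
  have PiE: "newton_unit G n \<in> fo G n \<rightarrow>\<^sub>E fo ?D n" for n
    unfolding foD by (auto simp: newton_unit_def)
  have "inj_on (newton_unit G n) (fo G n)" for n
  proof (rule inj_onI)
    fix a b assume ab: "a \<in> fo G n" "b \<in> fo G n" and "newton_unit G n a = newton_unit G n b"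
    then have "newton_nf G (n, \<lambda>i\<in>fincard n. i, a) = newton_nf G (n, \<lambda>i\<in>fincard n. i, b)"
      using newton_in_eq_iff[OF G, of "(n, \<lambda>i\<in>fincard n. i, a)" "fincard n" "(n, \<lambda>i\<in>fincard n. i, b)"]
        id_fincard by (simp add: newton_unit_apply newton_pre_iff)
    then show "a = b" by (rule newton_nf_id_inj[OF G ab])
  qed
  then have "is_iso (SET V) (fo G n) (fo ?D n) (newton_unit G n)" for n
    using sp_V[OF G] sp_V[OF D] PiE foD by (intro iso_SETI) (simp_all add: bij_betw_def)
  moreover have "compose (fo G m) (newton_unit G n) (fm G m n f) = compose (fo G m) (fm ?D m n f) (newton_unit G m)"
    if f: "f \<in> Hom Surj m n" for m n f
  proof (rule PiE_ext[OF compose_PiE[OF sp_PiE[OF G f] PiE] compose_PiE[OF PiE sp_PiE[OF D f]]])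
    fix b assume b: "b \<in> fo G m"
    \<comment> \<open>The unit element lies in the domain to which the arrow part of
      \<open>diff_star\<close> is restricted.\<close>
    then have "newton_unit G m b \<in> iter_diff_zero V (newton_sum V G) m"
      using foD by (simp add: fo_diff_star)
    then show "compose (fo G m) (newton_unit G n) (fm G m n f) b
        = compose (fo G m) (fm ?D m n f) (newton_unit G m) b"
      by (simp only: compose_eq[OF b] newton_unit_natural[OF G f b] fm_diff_star[OF f]
          fm_newton_sum[OF V_fincard V_fincard Surj_hom_PiE[OF f]] restrict_apply')
  qed
  ultimately show ?thesis
    unfolding natural_iso_def nat_trans_def using G D PiE by (simp del: Surj_sel(2))
qed

section \<open>Transposition and its inverse\<close>

lemma transpose_apply: "b \<in> fo G n \<Longrightarrow> transpose G t n b = t (fincard n) (newton_unit G n b)"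
  by (simp add: transpose_def)

lemma transpose_mem:
  assumes G: "is_functor Surj (SET V) G" and F: "taut_functor (SET V) (SET V) F"
    and t: "taut_trans (SET V) (SET V) (newton_sum V G) F t" and b: "b \<in> fo G n"
  shows "transpose G t n b \<in> iter_diff_zero V F n"
  unfolding transpose_apply[OF b]
  by (rule diff_trans[OF functor_newton_sum[OF G] taut_functor_is_functor[OF F] t])
     (use b iter_diff_zero_newton_sum[OF G] in blast)

lemma nat_trans_transpose:
  assumes G: "is_functor Surj (SET V) G" and F: "taut_functor (SET V) (SET V) F"
    and t: "taut_trans (SET V) (SET V) (newton_sum V G) F t"
  shows "nat_trans Surj (SET V) G (diff_star V F) (transpose G t)"
proof -
  note D = functor_diff_star[OF F]
  have PiE: "transpose G t n \<in> fo G n \<rightarrow>\<^sub>E fo (diff_star V F) n" for n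
    using transpose_mem[OF G F t] by (auto simp: fo_diff_star) (simp add: transpose_def)
  have "compose (fo G m) (transpose G t n) (fm G m n f)
      = compose (fo G m) (fm (diff_star V F) m n f) (transpose G t m)"
    if f: "f \<in> Hom Surj m n" for m n f
  proof (rule PiE_ext[OF compose_PiE[OF sp_PiE[OF G f] PiE] compose_PiE[OF PiE sp_PiE[OF D f]]])
    fix b assume b: "b \<in> fo G m"
    have "t (fincard n) (newton_unit G n (fm G m n f b)) =
        fm F (fincard m) (fincard n) f (t (fincard m) (newton_unit G m b))"
      using nat_trans_natural[OF taut_trans_nat[OF t] V_fincard V_fincard Surj_hom_PiE[OF f]]
        newton_unit_mem[OF b]
      by (simp add: fo_newton_sum fm_newton_sum V_fincard Surj_hom_PiE[OF f]
          newton_unit_natural[OF G f b] del: Surj_sel(2))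
    then show "compose (fo G m) (transpose G t n) (fm G m n f) b
        = compose (fo G m) (fm (diff_star V F) m n f) (transpose G t m) b"
      using transpose_mem[OF G F t b]
      by (simp only: compose_eq[OF b] fm_diff_star[OF f] restrict_apply')
         (simp only: transpose_apply[OF b] transpose_apply[OF sp_mem[OF G f b]])
  qed
  then show ?thesis
    unfolding nat_trans_def using G D PiE by (simp del: Surj_sel(2))
qed

lemma diff_star_mem:
  assumes F: "is_functor (SET V) (SET V) F" and s: "nat_trans Surj (SET V) G (diff_star V F) s"
    and a: "a \<in> fo G n"
  shows "s n a \<in> iter_diff_zero V F n" "s n a \<in> fo F (fincard n)"
  using sp_nat_mem[OF s a] iter_diff_zero_iff[OF F] by (auto simp: fo_diff_star)

text \<open>Naturality of \<open>s\<close> turns s(G(e) a) into F(e)(s a), the arrows of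
  \<open>diff_star V F\<close> being restrictions of those of F; functoriality does the rest. With
  the common reduct this makes \<open>untranspose\<close> well defined.\<close>

lemma fm_push:
  assumes F: "is_functor (SET V) (SET V) F" and s: "nat_trans Surj (SET V) G (diff_star V F) s"
    and e: "e \<in> Hom Surj n k" and m: "m \<in> fincard k \<rightarrow>\<^sub>E X" and X: "X \<in> V" and a: "a \<in> fo G n"
  shows "fm F (fincard n) X (compose (fincard n) m e) (s n a) = fm F (fincard k) X m (s k (fm G n k e a))"
  using fm_comp[OF F V_fincard V_fincard X Surj_hom_PiE[OF e] m] diff_star_mem[OF F s a]
  by (simp add: sp_natural[OF s e a] fm_diff_star[OF e] del: Surj_sel(2))

lemma untranspose_in:
  assumes F: "is_functor (SET V) (SET V) F" and s: "nat_trans Surj (SET V) G (diff_star V F) s"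
    and X: "X \<in> V" and x: "x \<in> fincard n \<rightarrow>\<^sub>E X" and a: "a \<in> fo G n"
  shows "untranspose V G F s X (newton_in G X (n, x, a)) = fm F (fincard n) X x (s n a)"
proof -
  have G: "is_functor Surj (SET V) G" by (rule nat_transD(1)[OF s])
  have pre: "(n, x, a) \<in> newton_pre G X" using x a by (simp add: newton_pre_iff)
  have "fm F (fincard n) X x (s n a) = fm F (fincard l) X y (s l b)"
    if y: "(l, y, b) \<in> newton_pre G X" and eq: "newton_in G X (n, x, a) = newton_in G X (l, y, b)" for l y b
  proof -
    have y': "y \<in> fincard l \<rightarrow>\<^sub>E X" "b \<in> fo G l" using y by (simp_all add: newton_pre_iff)
    have nf: "newton_nf G (n, x, a) = newton_nf G (l, y, b)" using newton_in_eq_iff[OF G pre y] eq by simp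
    obtain k m e e' where d: "m \<in> fincard k \<rightarrow>\<^sub>E X" "e \<in> Hom Surj n k" "e' \<in> Hom Surj l k"
      "x = compose (fincard n) m e" "y = compose (fincard l) m e'" "fm G n k e a = fm G l k e' b"
      by (rule newton_nf_decomp[OF x y'(1) nf])
    show ?thesis
      unfolding d(4,5) fm_push[OF F s d(2,1) X a] fm_push[OF F s d(3,1) X y'(2)] d(6) ..
  qed
  then show ?thesis
    unfolding untranspose_def
    using newton_descend[OF pre, of "\<lambda>n x a. fm F (fincard n) X x (s n a)"]
      newton_in_mem[OF x a] X by simp
qed

lemma untranspose_PiE:
  assumes F: "is_functor (SET V) (SET V) F" and s: "nat_trans Surj (SET V) G (diff_star V F) s"
    and X: "X \<in> V"
  shows "untranspose V G F s X \<in> newton_obj G X \<rightarrow>\<^sub>E fo F X"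
proof (rule PiE_I)
  fix z assume "z \<in> newton_obj G X"
  then show "untranspose V G F s X z \<in> fo F X"
    by (elim newton_objE)
       (simp add: untranspose_in[OF F s X] fm_mem[OF F V_fincard X] diff_star_mem(2)[OF F s])
qed (simp add: untranspose_def X)

lemma taut_trans_untranspose:
  assumes F: "taut_functor (SET V) (SET V) F" and s: "nat_trans Surj (SET V) G (diff_star V F) s"
  shows "taut_trans (SET V) (SET V) (newton_sum V G) F (untranspose V G F s)"
proof (rule taut_transI[OF _ F])
  have G: "is_functor Surj (SET V) G" by (rule nat_transD(1)[OF s])
  note F' = taut_functor_is_functor[OF F]
  show "taut_functor (SET V) (SET V) (newton_sum V G)" by (rule taut_newton_sum[OF G])
  have "compose (newton_obj G X) (untranspose V G F s Y) (newton_arr G X Y f)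
      = compose (newton_obj G X) (fm F X Y f) (untranspose V G F s X)"
    if V: "X \<in> V" "Y \<in> V" and f: "f \<in> X \<rightarrow>\<^sub>E Y" for X Y f
  proof (rule PiE_ext[OF compose_PiE[OF newton_arr_PiE[OF G f] untranspose_PiE[OF F' s V(2)]]
          compose_PiE[OF untranspose_PiE[OF F' s V(1)] fm_PiE[OF F' V f]]])
    fix z assume z: "z \<in> newton_obj G X"
    obtain n x a where x: "x \<in> fincard n \<rightarrow>\<^sub>E X" "a \<in> fo G n" "z = newton_in G X (n, x, a)"
      using newton_objE[OF z] .
    show "compose (newton_obj G X) (untranspose V G F s Y) (newton_arr G X Y f) z
        = compose (newton_obj G X) (fm F X Y f) (untranspose V G F s X) z"
      unfolding compose_eq[OF z] unfolding x(3) newton_arr_in[OF G f x(1,2)]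
        untranspose_in[OF F' s V(1) x(1,2)] untranspose_in[OF F' s V(2) compose_PiE[OF x(1) f] x(2)]
      by (rule fm_comp[OF F' V_fincard V x(1) f diff_star_mem(2)[OF F' s x(2)]])
  qed
  then show "nat_trans (SET V) (SET V) (newton_sum V G) F (untranspose V G F s)"
    unfolding nat_trans_def using functor_newton_sum[OF G] F' untranspose_PiE[OF F' s]
    by (simp add: fo_newton_sum fm_newton_sum untranspose_def)
  fix X S z assume X: "X \<in> V" "S \<subseteq> X" and z: "z \<in> fo (newton_sum V G) X"
    "untranspose V G F s X z \<in> img F X S"
  obtain n x a where x: "x \<in> fincard n \<rightarrow>\<^sub>E X" "a \<in> fo G n" "z = newton_in G X (n, x, a)"
    using z(1) unfolding fo_newton_sum[OF X(1)] by (rule newton_objE)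
  have "s n a \<in> img F (fincard n) {i \<in> fincard n. x i \<in> S}"
    using z(2) unfolding x(3) untranspose_in[OF F' s X(1) x(1,2)]
    by (rule taut_preimage[OF F V_fincard X(1) x(1) X(2) diff_star_mem(2)[OF F' s x(2)]])
  moreover have "{i \<in> fincard n. x i \<in> S} \<subseteq> fincard n" by (rule Collect_restrict)
  ultimately have "{i \<in> fincard n. x i \<in> S} = fincard n"
    using diff_star_mem(1)[OF F' s x(2)] by (simp only: iter_diff_zero_iff[OF F'])
  then show "z \<in> img (newton_sum V G) X S"
    unfolding x(3) newton_img_iff[OF G X x(1,2)] by blast
qed

text \<open>At a unit element the map \<open>x\<close> is the identity, which F preserves.\<close>

lemma transpose_untranspose:
  assumes F: "taut_functor (SET V) (SET V) F" and s: "nat_trans Surj (SET V) G (diff_star V F) s"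
  shows "transpose G (untranspose V G F s) = s"
proof
  fix n
  have G: "is_functor Surj (SET V) G" by (rule nat_transD(1)[OF s])
  note F' = taut_functor_is_functor[OF F]
  note t = nat_trans_transpose[OF G F taut_trans_untranspose[OF F s]]
  have "transpose G (untranspose V G F s) n \<in> fo G n \<rightarrow>\<^sub>E fo (diff_star V F) n"
    "s n \<in> fo G n \<rightarrow>\<^sub>E fo (diff_star V F) n"
    using nat_transD(4)[OF t, of n] nat_transD(4)[OF s, of n] by simp_all
  then show "transpose G (untranspose V G F s) n = s n"
  proof (rule PiE_ext)
    fix b assume b: "b \<in> fo G n"
    show "transpose G (untranspose V G F s) n b = s n b"
      unfolding transpose_apply[OF b] newton_unit_apply[OF b] untranspose_in[OF F' s V_fincard id_fincard b]
      by (rule fm_id[OF F' V_fincard diff_star_mem(2)[OF F' s b]])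
  qed
qed

text \<open>Naturality of \<open>t\<close> at \<open>x\<close> carries its value on the unit at
  \<open>a\<close> to its value on [n, x, a], which is the formula of
  \<open>untranspose\<close>.\<close>

lemma untranspose_transpose:
  assumes G: "is_functor Surj (SET V) G" and F: "taut_functor (SET V) (SET V) F"
    and t: "taut_trans (SET V) (SET V) (newton_sum V G) F t"
  shows "untranspose V G F (transpose G t) = t"
proof
  fix X
  note F' = taut_functor_is_functor[OF F]
  note s = nat_trans_transpose[OF G F t] and t' = taut_trans_nat[OF t]
  show "untranspose V G F (transpose G t) X = t X"
  proof (cases "X \<in> V")
    case True
    have "t X \<in> newton_obj G X \<rightarrow>\<^sub>E fo F X"
      using nat_transD(4)[OF t', of X] True by (simp add: fo_newton_sum)
    then show ?thesis
    proof (rule PiE_ext[OF untranspose_PiE[OF F' s True]])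
      fix z assume z: "z \<in> newton_obj G X"
      obtain n x a where x: "x \<in> fincard n \<rightarrow>\<^sub>E X" "a \<in> fo G n" "z = newton_in G X (n, x, a)"
        using newton_objE[OF z] .
      have "untranspose V G F (transpose G t) X z = fm F (fincard n) X x (t (fincard n) (newton_unit G n a))"
        unfolding x(3) untranspose_in[OF F' s True x(1,2)] transpose_apply[OF x(2)] ..
      also have "\<dots> = t X (newton_arr G (fincard n) X x (newton_unit G n a))"
        using nat_trans_natural[OF t' V_fincard True x(1)] newton_unit_mem[OF x(2)]
        by (simp add: fo_newton_sum fm_newton_sum V_fincard True x(1))
      also have "\<dots> = t X z" unfolding x(3) newton_arr_unit[OF G x(1,2)] ..
      finally show "untranspose V G F (transpose G t) X z = t X z" .
    qed
  next
    case False
    then show ?thesis using nat_transD(3)[OF t'] by (simp add: untranspose_def extensional_def)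
  qed
qed

text \<open>Newton summation of \<open>h\<close> takes the unit at \<open>b\<close> to the unit at
  \<open>h n b\<close>, so both sides apply \<open>t\<close> and then \<open>k\<close> to that unit
  element.\<close>

lemma transpose_natural:
  assumes h: "nat_trans Surj (SET V) G' G h" and F: "taut_functor (SET V) (SET V) F"
    and F': "taut_functor (SET V) (SET V) F'"
    and k: "taut_trans (SET V) (SET V) F F' k"
    and t: "taut_trans (SET V) (SET V) (newton_sum V G) F t"
  shows "transpose G' (trans_comp (SET V) (SET V) (newton_sum V G') F F' k
        (trans_comp (SET V) (SET V) (newton_sum V G') (newton_sum V G) F t (newton_trans V G' G h)))
    = trans_comp Surj (SET V) G' (diff_star V F) (diff_star V F') (diff_star_trans V F F' k)
        (trans_comp Surj (SET V) G' G (diff_star V F) (transpose G t) h)"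
proof (intro ext)
  fix n b
  have G: "is_functor Surj (SET V) G" by (rule nat_transD(2)[OF h])
  show "transpose G' (trans_comp (SET V) (SET V) (newton_sum V G') F F' k
        (trans_comp (SET V) (SET V) (newton_sum V G') (newton_sum V G) F t (newton_trans V G' G h))) n b
    = trans_comp Surj (SET V) G' (diff_star V F) (diff_star V F') (diff_star_trans V F F' k)
        (trans_comp Surj (SET V) G' G (diff_star V F) (transpose G t) h) n b"
  proof (cases "b \<in> fo G' n")
    case True
    have hb: "h n b \<in> fo G n" by (rule sp_nat_mem[OF h True])
    show ?thesis
      using newton_unit_mem[OF True] transpose_mem[OF G F t hb] transpose_apply[OF hb, of t]
      by (simp add: trans_comp_def transpose_apply[OF True] V_fincard fo_newton_sum compose_eq True
          newton_trans_unit[OF h True] diff_star_trans_def)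
  next
    case False
    then show ?thesis by (simp add: transpose_def trans_comp_def compose_def)
  qed
qed

end

theorem theorem5p1p9:
  fixes V :: "'u set set"
  assumes "set_universe V"
  shows "(\<exists>\<eta>. (\<forall>G :: 'u soft_species. is_functor Surj (SET V) G \<longrightarrow>
                 natural_iso Surj (SET V) G (diff_star V (newton_sum V G)) (\<eta> G)) \<and>
              nat_trans (SoftSp V) (SoftSp V)
                (id_functor (SoftSp V)) (functor_comp (SoftSp V) (DeltaStar V) (Newton V)) \<eta>)
       \<and> left_adjoint (SoftSp V) (Taut V) (Newton V) (DeltaStar V)"
proof (intro conjI)
  interpret universe V by unfold_locales (rule assms)
  \<comment> \<open>Natural transformations have to be \<open>undefined\<close> off the objects,
    hence the restriction.\<close>
  let ?\<eta> = "restrict newton_unit (Obj (SoftSp V))"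
  let ?DN = "functor_comp (SoftSp V) (DeltaStar V) (Newton V)"
  have fo: "fo ?DN G = diff_star V (newton_sum V G)" if G: "is_functor Surj (SET V) G" for G
    using G by (simp add: functor_comp_def fo_Newton fo_DeltaStar[OF taut_newton_sum])
  have fm: "fm ?DN G H t = diff_star_trans V (newton_sum V G) (newton_sum V H) (newton_trans V G H t)"
    if t: "nat_trans Surj (SET V) G H t" for G H t
    using nat_transD(1,2)[OF t] t
    by (simp add: functor_comp_def fo_Newton fm_Newton fm_DeltaStar[OF taut_newton_sum taut_newton_sum]
        taut_newton_trans)
  \<comment> \<open>Both routes send a label b to the unit of H at \<open>t n b\<close>. The
    description of the iterated difference of a Newton sum ensures that
    \<open>diff_star_trans\<close> is evaluated inside the set to which it is restricted.\<close>
  have square: "trans_comp Surj (SET V) G H (diff_star V (newton_sum V H)) (newton_unit H) t =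
      trans_comp Surj (SET V) G (diff_star V (newton_sum V G)) (diff_star V (newton_sum V H))
        (diff_star_trans V (newton_sum V G) (newton_sum V H) (newton_trans V G H t)) (newton_unit G)"
    if t: "nat_trans Surj (SET V) G H t" for G H t
    using iter_diff_zero_newton_sum[OF nat_transD(1)[OF t]]
    by (auto simp: trans_comp_def fun_eq_iff compose_def restrict_def diff_star_trans_def
        newton_trans_unit[OF t])
  have "nat_trans (SoftSp V) (SoftSp V) (id_functor (SoftSp V)) ?DN ?\<eta>"
    unfolding nat_trans_def
    using functor_id[OF category_SoftSp] functor_functor_comp[OF functor_Newton functor_DeltaStar]
      natural_iso_newton_unit
    by (auto simp: id_functor_def fo fm square natural_iso_def nat_transD(1,2))
  then show "\<exists>\<eta>. (\<forall>G :: 'u soft_species. is_functor Surj (SET V) G \<longrightarrow>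
                 natural_iso Surj (SET V) G (diff_star V (newton_sum V G)) (\<eta> G)) \<and>
              nat_trans (SoftSp V) (SoftSp V)
                (id_functor (SoftSp V)) (functor_comp (SoftSp V) (DeltaStar V) (Newton V)) \<eta>"
    using natural_iso_newton_unit by (intro exI[of _ ?\<eta>]) simp
  have "bij_betw (transpose G) {t. taut_trans (SET V) (SET V) (newton_sum V G) F t}
      {s. nat_trans Surj (SET V) G (diff_star V F) s}"
    if G: "is_functor Surj (SET V) G" and F: "taut_functor (SET V) (SET V) F" for G F
    by (rule bij_betwI[of _ _ _ "untranspose V G F"])
       (use G F in \<open>simp_all add: nat_trans_transpose taut_trans_untranspose
          transpose_untranspose untranspose_transpose\<close>)
  then show "left_adjoint (SoftSp V) (Taut V) (Newton V) (DeltaStar V)"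
    unfolding left_adjoint_def using functor_Newton functor_DeltaStar
    by (auto intro!: exI[of _ "\<lambda>G F. transpose G"]
        simp: fo_Newton fo_DeltaStar fm_Newton fm_DeltaStar transpose_natural)
qed

end
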